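(* Let black-box operations $\{q_j:j\in J\}$ be given, including multiplication by a complex constant. If all black-box operations $q_j$, $j\in J$, other than the multiplication $q_{-2}(x_1,x_2)=x_1x_2$, are affine, then a polynomial $p:\mathbb{C}^n\to\mathbb{C}$ is accurately evaluable (on $\mathbb{C}^n$, in the extended arithmetic with operations $\{q_j:j\in J\}$) if and only if $V(p)=\{x\in\mathbb{C}^n:p(x)=0\}$ is a union of varieties $V_{\mathcal{I}}(q_j)$ with $j\in J$.
   Context: Black boxes. A black-box operation takes finitely many inputs $x_1,\dots,x_k$ and produces a polynomial $q(x_1,\dots,x_k)$; it is affine if this polynomial has degree at most $1$. A fixed family $\{q_j:j\in J\}$ is given ($J$ may be infinite), with $\{-2,-1,0\}\subset J$ and $q_{-2}(x_1,x_2)=x_1x_2$, $q_{-1}(x_1,x_2)=x_1+x_2$, $q_0(x_1,x_2)=x_1-x_2$. The family is also assumed to include the operation $q^c(x)=c\cdot x$ of multiplication by a complex constant $c$. Extended arithmetic. An algorithm receives $x\in\mathbb{C}^n$ exactly and is a finite directed acyclic graph with input, computational, branching and output nodes. Each computational node applies some black-box operation $q_j$ to its inputs $a_1,\dots,a_l$ (possibly with repetitions) and returns $q_j(a_1,\dots,a_l)(1+\delta_i)$, with $\delta_i\in\mathbb{C}$ a rounding error attached to that node; the $\delta_i$ of different nodes are independent variables. Negation is also available and is exact. The algorithm may or may not use comparisons and branching. It terminates in finitely many steps; its output is $p_{comp}(x,\delta)$, $\delta=(\delta_1,\dots,\delta_k)$, and $p_{comp}(x,0)=p(x)$. It is accurate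 for $p$ on $\mathcal{D}$ if for every $0<\eta<1$ there is $0<\epsilon<1$ such that for all $x\in\mathcal{D}$ and all $\delta$ with all $|\delta_i|\le\epsilon$, $|p_{comp}(x,\delta)-p(x)|\le\eta|p(x)|$. The polynomial $p$ is accurately evaluable on $\mathcal{D}$ if an accurate algorithm exists. The sets $V_{\mathcal{I}}(q)$. Let $q(x_1,\dots,x_n)$ be a polynomial over $\mathbb{C}^n$ (the arguments of a black box are taken to be any of the variables of $\mathbb{C}^n$). Let $\mathcal{K}=\{1,\dots,n\}$, $\mathcal{K}^2_<=\{(i,j)\in\mathcal{K}\times\mathcal{K}: i<j\}$, $\mathcal{K}_Z\subseteq\mathcal{K}$, $\mathcal{K}_D,\mathcal{K}_S\subseteq\mathcal{K}^2_<$. Rewrite $q$ subject to the conditions $x_i=0$ for $i\in\mathcal{K}_Z$, $x_i=x_j$ for $(i,j)\in\mathcal{K}_D$, $x_i=-x_j$ for $(i,j)\in\mathcal{K}_S$ (eliminating the second variable of each pair), obtaining $\tilde q$; let $\mathcal{K}_R$ be the set of remaining independent variables. Choose $T\subseteq\mathcal{K}_R$ and expand $\tilde q=\sum_\alpha q_\alpha x_T^\alpha$ with each $q_\alpha$ a polynomial in the variables $x_{\mathcal{K}_R\setminus T}$ only; put $V_{T,\mathcal{K}_Z,\mathcal{K}_D,\mathcal{K}_S}(q)=\bigcap_\alpha V(q_\alpha)$. Finally choose $\mathcal{K}_N\subseteq\mathcal{K}_R\setminus T$ and let $V_{\mathcal{I}}(q)$, $\mathcal{I}=(T,\mathcal{K}_Z,\mathcal{K}_D,\mathcal{K}_S,\mathcal{K}_N)$,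 be the variety obtained from $V_{T,\mathcal{K}_Z,\mathcal{K}_D,\mathcal{K}_S}(q)$ by negating each variable in $\mathcal{K}_N$.
   Formalization: Added assumption: if p is a nonzero constant, some black box q_j has a nonzero constant term (otherwise all algorithms give 0 at x=0, although V(p) is empty, a V_I(q_{-2})). V_I(q_j) is formed among the arguments of q_j, which are then named by any variables of C^n. *)

theory Defs
  imports "HOL-Analysis.Analysis" "HOL-Library.Poly_Mapping"
begin

section \<open>Multivariate polynomials\<close>

text \<open>A monomial is a finitely supported exponent vector; a polynomial is a finitely
  supported map from monomials to complex coefficients.\<close>

type_synonym 'v cpoly = "('v \<Rightarrow>\<^sub>0 nat) \<Rightarrow>\<^sub>0 complex"

definition Const :: "complex \<Rightarrow> 'v cpoly" where
  "Const c = Poly_Mapping.single 0 c"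

definition Var :: "'v \<Rightarrow> 'v cpoly" where
  "Var i = Poly_Mapping.single (Poly_Mapping.single i 1) 1"

definition vars :: "'v cpoly \<Rightarrow> 'v set" where
  "vars p = (\<Union>m\<in>Poly_Mapping.keys p. Poly_Mapping.keys m)"

definition peval :: "('v \<Rightarrow> complex) \<Rightarrow> 'v cpoly \<Rightarrow> complex" where
  "peval x p = (\<Sum>m\<in>Poly_Mapping.keys p. Poly_Mapping.lookup p m *
      (\<Prod>i\<in>Poly_Mapping.keys m. x i ^ Poly_Mapping.lookup m i))"

definition psubst :: "('v \<Rightarrow> 'w cpoly) \<Rightarrow> 'v cpoly \<Rightarrow> 'w cpoly" where
  "psubst f p = (\<Sum>m\<in>Poly_Mapping.keys p. Const (Poly_Mapping.lookup p m) *
      (\<Prod>i\<in>Poly_Mapping.keys m. f i ^ Poly_Mapping.lookup m i))"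

definition affine_poly :: "'v cpoly \<Rightarrow> bool" where
  "affine_poly p \<longleftrightarrow>
     (\<forall>m\<in>Poly_Mapping.keys p. (\<Sum>i\<in>Poly_Mapping.keys m. Poly_Mapping.lookup m i) \<le> 1)"

definition zero_set :: "('n::finite) cpoly \<Rightarrow> (complex ^ 'n) set" where
  "zero_set p = {x. peval (($) x) p = 0}"


section \<open>Families of black boxes\<close>

text \<open>The operation with index \<open>j \<in> J\<close> takes \<open>ar j\<close> arguments and applies the polynomial
  \<open>q j\<close> to them; the arguments are numbered from 0, so \<open>q j\<close> is a polynomial in the variables
  \<open>0, \<dots>, ar j - 1\<close>. The indices \<open>j_mul\<close>, \<open>j_add\<close>, \<open>j_sub\<close> stand for \<open>-2\<close>, \<open>-1\<close>, \<open>0\<close>.\<close>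

definition black_box_family ::
    "'j set \<Rightarrow> ('j \<Rightarrow> nat) \<Rightarrow> ('j \<Rightarrow> nat cpoly) \<Rightarrow> 'j \<Rightarrow> 'j \<Rightarrow> 'j \<Rightarrow> bool" where
  "black_box_family J ar q j_mul j_add j_sub \<longleftrightarrow>
     (\<forall>j\<in>J. vars (q j) \<subseteq> {..<ar j}) \<and>
     j_mul \<in> J \<and> ar j_mul = 2 \<and> q j_mul = Var 0 * Var 1 \<and>
     j_add \<in> J \<and> ar j_add = 2 \<and> q j_add = Var 0 + Var 1 \<and>
     j_sub \<in> J \<and> ar j_sub = 2 \<and> q j_sub = Var 0 - Var 1"

definition has_scalar_mult :: "'j set \<Rightarrow> ('j \<Rightarrow> nat) \<Rightarrow> ('j \<Rightarrow> nat cpoly) \<Rightarrow> bool" where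
  "has_scalar_mult J ar q \<longleftrightarrow> (\<forall>c. \<exists>j\<in>J. ar j = 1 \<and> q j = Const c * Var 0)"


section \<open>Algorithms in extended arithmetic\<close>

text \<open>An algorithm is a list of nodes, executed from node 0. A node refers to a datum, which is
  either one of the input nodes \<open>x\<^sub>i\<close> or the result of an earlier node. The trailing numbers in
  a node are its successors in the flow of control (for \<open>Branch\<close>: first the one taken
  if the comparison holds, then the other one).\<close>

datatype 'n datum = Input 'n | Result nat

datatype ('j, 'n) node =
    Compute 'j "'n datum list" nat
  | Negate "'n datum" nat
  | Branch "complex \<Rightarrow> complex \<Rightarrow> bool" "'n datum" "'n datum" nat nat
  | Output "'n datum"

type_synonym ('j, 'n) algorithm = "('j, 'n) node list"

text \<open>\<open>C\<close> is the set of comparison relations between complex numbers that branching nodes may use;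
  it is empty if branching is not available. Successors are larger than the node itself, so the
  graph is acyclic.\<close>

fun wf_node :: "'j set \<Rightarrow> ('j \<Rightarrow> nat) \<Rightarrow> (complex \<Rightarrow> complex \<Rightarrow> bool) set \<Rightarrow> nat \<Rightarrow> nat
    \<Rightarrow> ('j, 'n) node \<Rightarrow> bool" where
  "wf_node J ar C N i (Compute j as k) \<longleftrightarrow> j \<in> J \<and> length as = ar j \<and> i < k \<and> k < N"
| "wf_node J ar C N i (Negate a k) \<longleftrightarrow> i < k \<and> k < N"
| "wf_node J ar C N i (Branch R a b k l) \<longleftrightarrow> R \<in> C \<and> i < k \<and> k < N \<and> i < l \<and> l < N"
| "wf_node J ar C N i (Output a) \<longleftrightarrow> True"

fun fetch :: "complex ^ 'n \<Rightarrow> (nat \<rightharpoonup> complex) \<Rightarrow> 'n datum \<Rightarrow> complex option" where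
  "fetch x M (Input i) = Some (x $ i)"
| "fetch x M (Result k) = M k"

text \<open>\<open>exec q G x \<delta> i M y\<close>: control having reached node \<open>i\<close> of \<open>G\<close>, with the results \<open>M\<close> of
  the nodes visited so far, the output is \<open>y\<close>. The rounding error of the computational
  node \<open>i\<close> is \<open>\<delta> i\<close>. Execution gets stuck on references to results not yet computed.\<close>

inductive exec :: "('j \<Rightarrow> nat cpoly) \<Rightarrow> ('j, 'n) algorithm \<Rightarrow> complex ^ 'n \<Rightarrow> (nat \<Rightarrow> complex)
    \<Rightarrow> nat \<Rightarrow> (nat \<rightharpoonup> complex) \<Rightarrow> complex \<Rightarrow> bool"
  for q :: "'j \<Rightarrow> nat cpoly" and G :: "('j, 'n) algorithm" and x :: "complex ^ 'n"
    and \<delta> :: "nat \<Rightarrow> complex" where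
  compute: "i < length G \<Longrightarrow> G ! i = Compute j as k \<Longrightarrow> map (fetch x M) as = map Some vs \<Longrightarrow>
    exec q G x \<delta> k (M(i \<mapsto> peval (\<lambda>r. vs ! r) (q j) * (1 + \<delta> i))) y \<Longrightarrow> exec q G x \<delta> i M y"
| negate: "i < length G \<Longrightarrow> G ! i = Negate a k \<Longrightarrow> fetch x M a = Some v \<Longrightarrow>
    exec q G x \<delta> k (M(i \<mapsto> - v)) y \<Longrightarrow> exec q G x \<delta> i M y"
| branch: "i < length G \<Longrightarrow> G ! i = Branch R a b k l \<Longrightarrow> fetch x M a = Some v \<Longrightarrow>
    fetch x M b = Some w \<Longrightarrow> exec q G x \<delta> (if R v w then k else l) M y \<Longrightarrow> exec q G x \<delta> i M y"
| out: "i < length G \<Longrightarrow> G ! i = Output a \<Longrightarrow> fetch x M a = Some y \<Longrightarrow> exec q G x \<delta> i M y"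

lemma exec_deterministic:
  assumes "exec q G x \<delta> i M y" and "exec q G x \<delta> i M z"
  shows "y = z"
  using assms
proof (induction arbitrary: z rule: exec.induct)
  case (compute i j as k M vs y)
  from compute.prems compute.hyps obtain ws where
    ws: "map (fetch x M) as = map Some ws"
    and ex: "exec q G x \<delta> k (M(i \<mapsto> peval (\<lambda>r. ws ! r) (q j) * (1 + \<delta> i))) z"
    by (auto elim: exec.cases)
  from ws compute.hyps have "ws = vs"
    by (metis inj_map_eq_map inj_Some)
  from compute.IH ex[unfolded this] show ?case by blast
next
  case (negate i a k M v y)
  from negate.prems negate.hyps have "exec q G x \<delta> k (M(i \<mapsto> - v)) z"
    by cases auto
  with negate.IH show ?case by blast
next
  case (branch i R a b k l M v w y)
  from branch.prems branch.hyps have "exec q G x \<delta> (if R v w then k else l) M z"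
    by cases auto
  with branch.IH show ?case by simp
next
  case (out i a M y)
  then show ?case by (auto elim: exec.cases)
qed

definition is_algorithm :: "'j set \<Rightarrow> ('j \<Rightarrow> nat) \<Rightarrow> ('j \<Rightarrow> nat cpoly)
    \<Rightarrow> (complex \<Rightarrow> complex \<Rightarrow> bool) set \<Rightarrow> ('j, 'n::finite) algorithm \<Rightarrow> bool" where
  "is_algorithm J ar q C G \<longleftrightarrow>
     (\<forall>i<length G. wf_node J ar C (length G) i (G ! i)) \<and>
     (\<forall>x \<delta>. \<exists>y. exec q G x \<delta> 0 Map.empty y)"

definition p_comp :: "('j \<Rightarrow> nat cpoly) \<Rightarrow> ('j, 'n::finite) algorithm \<Rightarrow> complex ^ 'n
    \<Rightarrow> (nat \<Rightarrow> complex) \<Rightarrow> complex" where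
  "p_comp q G x \<delta> = (THE y. exec q G x \<delta> 0 Map.empty y)"

definition accurate_on :: "('j \<Rightarrow> nat cpoly) \<Rightarrow> ('j, 'n::finite) algorithm \<Rightarrow> 'n cpoly
    \<Rightarrow> (complex ^ 'n) set \<Rightarrow> bool" where
  "accurate_on q G p D \<longleftrightarrow>
     (\<forall>\<eta>::real. 0 < \<eta> \<and> \<eta> < 1 \<longrightarrow> (\<exists>\<epsilon>::real. 0 < \<epsilon> \<and> \<epsilon> < 1 \<and>
        (\<forall>x\<in>D. \<forall>\<delta>. (\<forall>i<length G. norm (\<delta> i) \<le> \<epsilon>) \<longrightarrow>
           norm (p_comp q G x \<delta> - peval (($) x) p) \<le> \<eta> * norm (peval (($) x) p))))"

definition accurately_evaluable_on :: "'j set \<Rightarrow> ('j \<Rightarrow> nat) \<Rightarrow> ('j \<Rightarrow> nat cpoly)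
    \<Rightarrow> (complex \<Rightarrow> complex \<Rightarrow> bool) set \<Rightarrow> ('n::finite) cpoly \<Rightarrow> (complex ^ 'n) set \<Rightarrow> bool" where
  "accurately_evaluable_on J ar q C p D \<longleftrightarrow>
     (\<exists>G. is_algorithm J ar q C G \<and>
          (\<forall>x\<in>D. p_comp q G x (\<lambda>_. 0) = peval (($) x) p) \<and>
          accurate_on q G p D)"


section \<open>The varieties \<open>V\<^sub>I(q)\<close>\<close>

text \<open>Here \<open>q\<close> is a polynomial in the variables \<open>0, \<dots>, k - 1\<close>, and points are functions on \<open>nat\<close>
  of which only the first \<open>k\<close> coordinates matter. The rewriting of \<open>q\<close> is read off from the linear
  space cut out by the conditions: a variable vanishing on it is replaced by 0, every other one by
  plus or minus the smallest variable it is identified with up to sign.\<close>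

definition cond_space :: "nat set \<Rightarrow> (nat \<times> nat) set \<Rightarrow> (nat \<times> nat) set \<Rightarrow> (nat \<Rightarrow> complex) set" where
  "cond_space KZ KD KS = {y. (\<forall>i\<in>KZ. y i = 0) \<and> (\<forall>(i, j)\<in>KD. y i = y j) \<and> (\<forall>(i, j)\<in>KS. y i = - y j)}"

definition rep :: "(nat \<Rightarrow> complex) set \<Rightarrow> nat \<Rightarrow> nat" where
  "rep L i = (LEAST r. (\<forall>y\<in>L. y i = y r) \<or> (\<forall>y\<in>L. y i = - y r))"

definition rewrite_var :: "(nat \<Rightarrow> complex) set \<Rightarrow> nat \<Rightarrow> nat cpoly" where
  "rewrite_var L i =
     (if \<forall>y\<in>L. y i = 0 then 0
      else if \<forall>y\<in>L. y i = y (rep L i) then Var (rep L i)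
      else - Var (rep L i))"

definition remaining :: "nat \<Rightarrow> (nat \<Rightarrow> complex) set \<Rightarrow> nat set" where
  "remaining k L = {i. i < k \<and> \<not> (\<forall>y\<in>L. y i = 0) \<and> rep L i = i}"

definition restrict_mono :: "'v set \<Rightarrow> ('v \<Rightarrow>\<^sub>0 nat) \<Rightarrow> ('v \<Rightarrow>\<^sub>0 nat)" where
  "restrict_mono T m = Poly_Mapping.mapp (\<lambda>i e. if i \<in> T then e else 0) m"

text \<open>The coefficient of \<open>x\<^sub>T\<^sup>\<alpha>\<close>, a polynomial in the variables outside \<open>T\<close>.\<close>

definition coeff_in :: "'v set \<Rightarrow> ('v \<Rightarrow>\<^sub>0 nat) \<Rightarrow> 'v cpoly \<Rightarrow> 'v cpoly" where
  "coeff_in T \<alpha> q = (\<Sum>m \<in> {m \<in> Poly_Mapping.keys q. restrict_mono T m = \<alpha>}.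
      Poly_Mapping.single (restrict_mono (- T) m) (Poly_Mapping.lookup q m))"

definition V_TZDS :: "nat set \<Rightarrow> nat set \<Rightarrow> (nat \<times> nat) set \<Rightarrow> (nat \<times> nat) set \<Rightarrow> nat cpoly
    \<Rightarrow> (nat \<Rightarrow> complex) set" where
  "V_TZDS T KZ KD KS q =
     (\<Inter>\<alpha>. {y. peval y (coeff_in T \<alpha> (psubst (rewrite_var (cond_space KZ KD KS)) q)) = 0})"

definition V_I :: "nat set \<Rightarrow> nat set \<Rightarrow> (nat \<times> nat) set \<Rightarrow> (nat \<times> nat) set \<Rightarrow> nat set \<Rightarrow> nat cpoly
    \<Rightarrow> (nat \<Rightarrow> complex) set" where
  "V_I T KZ KD KS KN q = {y. (\<lambda>i. if i \<in> KN then - y i else y i) \<in> V_TZDS T KZ KD KS q}"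

definition admissible_index :: "nat \<Rightarrow> nat set \<Rightarrow> nat set \<Rightarrow> (nat \<times> nat) set \<Rightarrow> (nat \<times> nat) set
    \<Rightarrow> nat set \<Rightarrow> bool" where
  "admissible_index k T KZ KD KS KN \<longleftrightarrow>
     KZ \<subseteq> {..<k} \<and>
     KD \<subseteq> {(i, j). i < j \<and> j < k} \<and>
     KS \<subseteq> {(i, j). i < j \<and> j < k} \<and>
     T \<subseteq> remaining k (cond_space KZ KD KS) \<and>
     KN \<subseteq> remaining k (cond_space KZ KD KS) - T"

text \<open>The varieties in \<open>\<complex>\<^sup>n\<close> belonging to a black box \<open>q\<close> with \<open>k\<close> arguments: \<open>s\<close> says which
  variable of \<open>\<complex>\<^sup>n\<close> is taken for which argument. Since \<open>k\<close> need not equal \<open>n\<close>, the reduction by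
  \<open>K\<^sub>Z, K\<^sub>D, K\<^sub>S, T, K\<^sub>N\<close> takes place among the arguments, before they are named by variables
  of \<open>\<complex>\<^sup>n\<close>.\<close>

definition black_box_varieties :: "nat \<Rightarrow> nat cpoly \<Rightarrow> (complex ^ 'n::finite) set set" where
  "black_box_varieties k q =
     {{x. (\<lambda>i. x $ s i) \<in> V_I T KZ KD KS KN q} | s T KZ KD KS KN. admissible_index k T KZ KD KS KN}"

end

theory Submission
  imports Defs "HOL-Computational_Algebra.Fundamental_Theorem_Algebra"
begin

text \<open>
  A form is a black box \<open>q\<^sub>j\<close>, other than the multiplication, whose arguments are set to 0 or to
  variables up to sign. The forms are affine, and their zeros are hyperplanes as long as
  they are not constant. The theorem holds because both sides of the equivalence mean that \<open>p\<close> is zero,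
  or a constant multiple of a product of forms.

  \<^bold>\<open>Geometry.\<close> The varieties \<open>V\<^sub>I(q\<^sub>j)\<close> are built from the zeros of forms: the zeros of every form are
  such a variety (\<open>form_zeros_variety\<close>), and a variety that is not the whole space contains with each of
  its points the zeros of a form through this point
  (\<open>affine_variety_contains_form_zeros\<close>, \<open>product_variety_contains_hyperplane\<close>). If \<open>p\<close> is not zero
  and its zeros are a union of hyperplanes, or covered by finitely many of them, then \<open>p\<close> is a product
  of corresponding affine functions up to a constant (\<open>product_of_affine\<close>, \<open>product_of_affine_finite\<close>).
  This is proved by restricting polynomials to lines, where the fundamental theorem of algebra applies.

  \<^bold>\<open>Products of forms are evaluable.\<close> A form is the result of one black box whose operands, the inputs
  up to sign and 0, are available exactly; so it carries one factor \<open>1 + \<delta>\<^sub>i\<close>.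
  Products collect such factors, and a product of these factors is close to 1 for small errors
  (\<open>union_imp_evaluable\<close>).

  \<^bold>\<open>Evaluable polynomials are products of forms.\<close> Let \<open>w\<close> be a point where no coordinate
  vanishes and no form of a black box in the algorithm, unless this form vanishes everywhere. Along a
  path through the algorithm every value is a polynomial in the input and the rounding errors. By
  induction along the path, such a value is either zero everywhere or not identically zero in the rounding errors at \<open>w\<close>: for products because
  polynomials have no zero divisors, and for affine black boxes because the rounding errors make
  results of distinct nodes linearly independent (\<open>rounded_independent\<close>), so that cancellation can only
  happen among the inputs, that is, in a form (\<open>affine_value_tame\<close>). There are only finitely many paths,
  whatever comparisons are used. Thus for suitable small rounding errors the computed
  value does not tend to 0 as the input tends to \<open>w\<close>, and by accuracy \<open>p\<close> does not vanish at \<open>w\<close>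
  (\<open>accurate_zero_on_forms\<close>). So the zeros of \<open>p\<close> are covered by those of finitely many forms.
\<close>

section \<open>Evaluation of polynomials\<close>

abbreviation "keys \<equiv> Poly_Mapping.keys"
abbreviation "lookup \<equiv> Poly_Mapping.lookup"

definition mon :: "('v \<Rightarrow> complex) \<Rightarrow> ('v \<Rightarrow>\<^sub>0 nat) \<Rightarrow> complex" where
  "mon x m = (\<Prod>i\<in>keys m. x i ^ lookup m i)"

lemma mon_superset:
  assumes "finite A" "keys m \<subseteq> A"
  shows "mon x m = (\<Prod>i\<in>A. x i ^ lookup m i)"
  unfolding mon_def using assms
  by (intro prod.mono_neutral_left) (auto simp: in_keys_iff)

lemma mon_add: "mon x (m + n) = mon x m * mon x n"
proof -
  let ?A = "keys m \<union> keys n"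
  have "mon x (m + n) = (\<Prod>i\<in>?A. x i ^ lookup (m + n) i)"
    by (rule mon_superset) (auto simp: Poly_Mapping.keys_add)
  also have "\<dots> = (\<Prod>i\<in>?A. x i ^ lookup m i) * (\<Prod>i\<in>?A. x i ^ lookup n i)"
    by (simp add: lookup_add power_add prod.distrib)
  also have "\<dots> = mon x m * mon x n"
    using mon_superset[of ?A m x] mon_superset[of ?A n x] by simp
  finally show ?thesis .
qed

lemma mon_0 [simp]: "mon x 0 = 1"
  by (simp add: mon_def)

lemma mon_single [simp]: "mon x (Poly_Mapping.single i k) = x i ^ k"
  by (simp add: mon_def)

lemma mon_times: "mon (\<lambda>i. x i * y i) m = mon x m * mon y m"
  by (simp add: mon_def power_mult_distrib prod.distrib)

lemma peval_superset:
  assumes "finite A" "keys p \<subseteq> A"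
  shows "peval x p = (\<Sum>m\<in>A. lookup p m * mon x m)"
  unfolding peval_def mon_def using assms
  by (intro sum.mono_neutral_left) (auto simp: in_keys_iff)

lemma peval_mon: "peval x p = (\<Sum>m\<in>keys p. lookup p m * mon x m)"
  by (rule peval_superset) auto

lemma peval_add [simp]: "peval x (p + r) = peval x p + peval x r"
proof -
  let ?A = "keys p \<union> keys r"
  have "peval x (p + r) = (\<Sum>m\<in>?A. lookup (p + r) m * mon x m)"
    by (rule peval_superset) (auto simp: Poly_Mapping.keys_add)
  also have "\<dots> = (\<Sum>m\<in>?A. lookup p m * mon x m) + (\<Sum>m\<in>?A. lookup r m * mon x m)"
    by (simp add: lookup_add ring_distribs sum.distrib)
  also have "\<dots> = peval x p + peval x r"
    using peval_superset[of ?A p x] peval_superset[of ?A r x] by simp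
  finally show ?thesis .
qed

lemma peval_single [simp]: "peval x (Poly_Mapping.single m c) = c * mon x m"
  by (cases "c = 0") (simp_all add: peval_mon)

lemma peval_0 [simp]: "peval x 0 = 0"
  by (simp add: peval_mon)

lemma peval_sum [simp]: "peval x (sum f A) = (\<Sum>a\<in>A. peval x (f a))"
  by (induction A rule: infinite_finite_induct) auto

lemma peval_minus [simp]: "peval x (- p) = - peval x p"
  by (metis add_eq_0_iff peval_0 peval_add right_minus)

lemma peval_diff [simp]: "peval x (p - r) = peval x p - peval x r"
  by (metis diff_conv_add_uminus peval_add peval_minus)

lemma peval_Const [simp]: "peval x (Const c) = c"
  by (simp add: Const_def)

lemma peval_Var [simp]: "peval x (Var i) = x i"
  by (simp add: Var_def)

lemma sum_monomials: "(\<Sum>m\<in>keys p. Poly_Mapping.single m (lookup p m)) = p"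
  by (rule poly_mapping_eqI) (auto simp: lookup_sum lookup_single when_def in_keys_iff)

lemma peval_mult [simp]: "peval x (p * r) = peval x p * peval x r"
proof -
  let ?s = "\<lambda>p m. Poly_Mapping.single m (lookup p m)"
  have "p * r = (\<Sum>m\<in>keys p. ?s p m) * (\<Sum>n\<in>keys r. ?s r n)"
    by (simp add: sum_monomials)
  also have "\<dots> = (\<Sum>m\<in>keys p. \<Sum>n\<in>keys r.
      Poly_Mapping.single (m + n) (lookup p m * lookup r n))"
    by (simp add: sum_product mult_single)
  finally have "peval x (p * r) =
      (\<Sum>m\<in>keys p. \<Sum>n\<in>keys r. lookup p m * lookup r n * (mon x m * mon x n))"
    by (simp add: mon_add)
  also have "\<dots> = peval x p * peval x r"
    unfolding peval_mon sum_product by (intro sum.cong) (auto simp: algebra_simps)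
  finally show ?thesis .
qed

lemma peval_1 [simp]: "peval x 1 = 1"
  by (metis mon_0 mult_1 peval_single single_one)

lemma peval_power [simp]: "peval x (p ^ k) = peval x p ^ k"
  by (induction k) auto

lemma peval_prod [simp]: "peval x (prod f A) = (\<Prod>a\<in>A. peval x (f a))"
  by (induction A rule: infinite_finite_induct) auto

lemma peval_psubst: "peval x (psubst f p) = peval (\<lambda>i. peval x (f i)) p"
  by (simp add: psubst_def peval_def[of _ p])

lemma peval_cong:
  assumes "\<And>i. i \<in> vars p \<Longrightarrow> x i = y i"
  shows "peval x p = peval y p"
  unfolding peval_def
proof (intro sum.cong arg_cong2[where f = "(*)"] prod.cong refl)
  fix m i assume "m \<in> keys p" "i \<in> keys m"
  then have "i \<in> vars p" by (auto simp: vars_def)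
  then show "x i ^ lookup m i = y i ^ lookup m i" using assms by simp
qed

text \<open>Monomials are pairwise distinct characters of the multiplicative monoid of points, so
  Dedekind's argument makes them linearly independent: scaling one coordinate by 2 and subtracting
  a multiple of the relation removes one monomial and separates the others from it.\<close>

lemma mon_independent:
  assumes "finite A" "\<And>x. (\<Sum>m\<in>A. c m * mon x m) = 0" "m \<in> A"
  shows "c m = 0"
  using assms
proof (induction A arbitrary: c m rule: finite_induct)
  case empty
  then show ?case by simp
next
  case (insert n A)
  have A: "c k = 0" if "k \<in> A" for k
  proof -
    from that insert.hyps have "k \<noteq> n" by auto
    then obtain i where i: "lookup k i \<noteq> lookup n i"
      by (meson poly_mapping_eqI)
    define y :: "'a \<Rightarrow> complex" where "y = (\<lambda>_. 1)(i := 2)"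
    have y: "mon y l = 2 ^ lookup l i" for l :: "'a \<Rightarrow>\<^sub>0 nat"
    proof -
      have "mon y l = (\<Prod>j\<in>insert i (keys l). y j ^ lookup l j)"
        by (rule mon_superset) auto
      also have "\<dots> = y i ^ lookup l i * (\<Prod>j\<in>insert i (keys l) - {i}. y j ^ lookup l j)"
        by (rule prod.remove) auto
      also have "(\<Prod>j\<in>insert i (keys l) - {i}. y j ^ lookup l j) = 1"
        by (rule prod.neutral) (auto simp: y_def)
      also have "y i = 2" by (simp add: y_def)
      finally show ?thesis by simp
    qed
    have "(\<Sum>m\<in>A. c m * (mon y m - mon y n) * mon x m) = 0" for x
    proof -
      have "(\<Sum>m\<in>insert n A. c m * mon (\<lambda>i. y i * x i) m) -
          mon y n * (\<Sum>m\<in>insert n A. c m * mon x m) = 0"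
        by (simp only: insert.prems(1)) simp
      then show ?thesis
        using insert.hyps
        by (simp add: mon_times sum_distrib_left ring_distribs sum_subtractf mult_ac)
    qed
    from insert.IH[OF this \<open>k \<in> A\<close>] have "c k * (mon y k - mon y n) = 0" .
    moreover have "mon y k \<noteq> mon y n"
      using i unfolding y
      by (metis norm_numeral norm_power one_less_numeral_iff power_inject_exp semiring_norm(76))
    ultimately show ?thesis by simp
  qed
  have "c n = 0"
    using insert.prems(1)[of "\<lambda>_. 1"] insert.hyps A by (simp add: mon_def)
  with A insert.prems(2) show ?case by auto
qed

lemma peval_eq_imp_eq:
  assumes "\<And>x. peval x p = peval x r"
  shows "p = r"
proof -
  have *: "lookup (p - r) m = 0" if "m \<in> keys (p - r)" for m
    using mon_independent[of "keys (p - r)" "lookup (p - r)"] that assms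
    by (metis cancel_comm_monoid_add_class.diff_cancel finite_keys peval_diff peval_mon)
  have "p - r = 0"
  proof (rule poly_mapping_eqI)
    show "lookup (p - r) m = lookup 0 m" for m
      using *[of m] by (cases "m \<in> keys (p - r)") (auto simp: in_keys_iff)
  qed
  then show ?thesis by simp
qed


section \<open>Polynomial functions on lines\<close>

text \<open>Points are functions on an arbitrary index type, so that the notion applies to the dependence on
  the input and to the dependence on the rounding errors alike.\<close>

inductive polyfun :: "(('v \<Rightarrow> complex) \<Rightarrow> complex) \<Rightarrow> bool" where
  const [simp]: "polyfun (\<lambda>_. c)"
| coord [simp]: "polyfun (\<lambda>x. x i)"
| add [simp]: "polyfun f \<Longrightarrow> polyfun g \<Longrightarrow> polyfun (\<lambda>x. f x + g x)"
| mult [simp]: "polyfun f \<Longrightarrow> polyfun g \<Longrightarrow> polyfun (\<lambda>x. f x * g x)"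

lemma polyfun_minus [simp]: "polyfun f \<Longrightarrow> polyfun (\<lambda>x. - f x)"
  using polyfun.mult[OF polyfun.const[of "-1"]] by simp

lemma polyfun_diff [simp]: "polyfun f \<Longrightarrow> polyfun g \<Longrightarrow> polyfun (\<lambda>x. f x - g x)"
  using polyfun.add[OF _ polyfun_minus] by fastforce

lemma polyfun_divide [simp]: "polyfun f \<Longrightarrow> polyfun (\<lambda>x. f x / c)"
  using polyfun.mult[OF _ polyfun.const[of "inverse c"]] by (simp add: field_simps)

lemma polyfun_sum [simp]:
  "(\<And>a. a \<in> A \<Longrightarrow> polyfun (f a)) \<Longrightarrow> polyfun (\<lambda>x. \<Sum>a\<in>A. f a x)"
  by (induction A rule: infinite_finite_induct) auto

lemma polyfun_prod [simp]:
  "(\<And>a. a \<in> A \<Longrightarrow> polyfun (f a)) \<Longrightarrow> polyfun (\<lambda>x. \<Prod>a\<in>A. f a x)"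
  by (induction A rule: infinite_finite_induct) auto

lemma polyfun_power [simp]: "polyfun f \<Longrightarrow> polyfun (\<lambda>x. f x ^ k)"
  by (induction k) auto

lemma polyfun_peval:
  "(\<And>i. polyfun (\<lambda>x. f x i)) \<Longrightarrow> polyfun (\<lambda>x. peval (f x) p)"
  unfolding peval_def by simp

lemma polyfun_compose:
  assumes "polyfun f" "\<And>i. polyfun (\<lambda>x. g x i)"
  shows "polyfun (\<lambda>x. f (g x))"
  using assms by (induction rule: polyfun.induct) simp_all

text \<open>The uniform degree bound is what bounds the number of linear factors of \<open>f\<close>.\<close>

lemma polyfun_on_lines:
  assumes "polyfun f"
  obtains d where "\<And>a b. \<exists>P. degree P \<le> d \<and> (\<forall>t. f (\<lambda>i. a i + t * b i) = poly P t)"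
proof -
  have "\<exists>d. \<forall>a b. \<exists>P. degree P \<le> d \<and> (\<forall>t. f (\<lambda>i. a i + t * b i) = poly P t)"
    using assms
  proof induction
    case (const c)
    show ?case by (intro exI[of _ "0::nat"] allI exI[of _ "[:c:]"]) auto
  next
    case (coord i)
    show ?case
    proof (intro exI[of _ "1::nat"] allI)
      fix a b :: "'a \<Rightarrow> complex"
      show "\<exists>P. degree P \<le> 1 \<and> (\<forall>t. a i + t * b i = poly P t)"
        by (intro exI[of _ "[:a i, b i:]"]) auto
    qed
  next
    case (add f g)
    then obtain d e where
      d: "\<And>a b. \<exists>P. degree P \<le> d \<and> (\<forall>t. f (\<lambda>i. a i + t * b i) = poly P t)" and
      e: "\<And>a b. \<exists>P. degree P \<le> e \<and> (\<forall>t. g (\<lambda>i. a i + t * b i) = poly P t)" by blast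
    show ?case
    proof (intro exI[of _ "max d e"] allI)
      fix a b
      from d[of a b] e[of a b] obtain P Q where
        "degree P \<le> d" "\<forall>t. f (\<lambda>i. a i + t * b i) = poly P t"
        "degree Q \<le> e" "\<forall>t. g (\<lambda>i. a i + t * b i) = poly Q t" by blast
      then show "\<exists>P. degree P \<le> max d e \<and>
          (\<forall>t. f (\<lambda>i. a i + t * b i) + g (\<lambda>i. a i + t * b i) = poly P t)"
        by (intro exI[of _ "P + Q"]) (auto intro!: degree_add_le simp: le_max_iff_disj)
    qed
  next
    case (mult f g)
    then obtain d e where
      d: "\<And>a b. \<exists>P. degree P \<le> d \<and> (\<forall>t. f (\<lambda>i. a i + t * b i) = poly P t)" and
      e: "\<And>a b. \<exists>P. degree P \<le> e \<and> (\<forall>t. g (\<lambda>i. a i + t * b i) = poly P t)" by blast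
    show ?case
    proof (intro exI[of _ "d + e"] allI)
      fix a b
      from d[of a b] e[of a b] obtain P Q where
        "degree P \<le> d" "\<forall>t. f (\<lambda>i. a i + t * b i) = poly P t"
        "degree Q \<le> e" "\<forall>t. g (\<lambda>i. a i + t * b i) = poly Q t" by blast
      then show "\<exists>P. degree P \<le> d + e \<and>
          (\<forall>t. f (\<lambda>i. a i + t * b i) * g (\<lambda>i. a i + t * b i) = poly P t)"
        by (intro exI[of _ "P * Q"])
          (auto intro: order_trans[OF degree_mult_le] add_mono)
    qed
  qed
  then show thesis using that by blast
qed

lemma polyfun_on_line:
  assumes "polyfun f"
  obtains P where "\<And>t. f (\<lambda>i. a i + t * b i) = poly P t"
  using polyfun_on_lines[OF assms] by metis

text \<open>This is the irreducibility of affine spaces: the set \<open>A\<close> contains with two points the line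
  through them, and on a line a nonzero polynomial has finitely many roots only. Hence from a point
  where some of the functions do not vanish and a point where another one does not,
  one finds a point of the connecting line where none of them does.\<close>

lemma common_nonzero:
  assumes "finite I" "\<And>k. k \<in> I \<Longrightarrow> polyfun (f k)" "\<And>k. k \<in> I \<Longrightarrow> \<exists>a\<in>A. f k a \<noteq> 0"
    and "A \<noteq> {}"
    and lines: "\<And>a b t. a \<in> A \<Longrightarrow> b \<in> A \<Longrightarrow> (\<lambda>i. a i + t * (b i - a i)) \<in> A"
  shows "\<exists>a\<in>A. \<forall>k\<in>I. f k a \<noteq> 0"
  using assms(1-3)
proof (induction I rule: finite_induct)
  case empty
  with \<open>A \<noteq> {}\<close> show ?case by auto
next
  case (insert n I)
  then obtain a where a: "a \<in> A" "\<forall>k\<in>I. f k a \<noteq> 0" by auto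
  obtain b where b: "b \<in> A" "f n b \<noteq> 0" using insert.prems by auto
  have "\<forall>k\<in>insert n I. \<exists>P. \<forall>t. f k (\<lambda>i. a i + t * (b i - a i)) = poly P t"
    using polyfun_on_line insert.prems(1) by metis
  then obtain P where P: "\<And>k t. k \<in> insert n I \<Longrightarrow> f k (\<lambda>i. a i + t * (b i - a i)) = poly (P k) t"
    by metis
  have "P k \<noteq> 0" if "k \<in> insert n I" for k
  proof (cases "k = n")
    case True
    then show ?thesis using P[of n 1] b by auto
  next
    case False
    then show ?thesis using P[of k 0] a that by auto
  qed
  then have "finite {t. poly (\<Prod>k\<in>insert n I. P k) t = 0}"
    using insert.hyps by (intro poly_roots_finite) auto
  then obtain t where "poly (\<Prod>k\<in>insert n I. P k) t \<noteq> 0"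
    using ex_new_if_finite[OF infinite_UNIV_char_0[where 'a = complex]] by blast
  then have "\<forall>k\<in>insert n I. poly (P k) t \<noteq> 0"
    using insert.hyps by (auto simp: poly_prod)
  with P have "\<forall>k\<in>insert n I. f k (\<lambda>i. a i + t * (b i - a i)) \<noteq> 0" by simp
  with lines[OF a(1) b(1)] show ?case by (intro bexI)
qed

lemma common_nonzero_UNIV:
  assumes "finite I" "\<And>k. k \<in> I \<Longrightarrow> polyfun (f k)" "\<And>k. k \<in> I \<Longrightarrow> \<exists>a. f k a \<noteq> 0"
  shows "\<exists>a. \<forall>k\<in>I. f k a \<noteq> 0"
  using common_nonzero[of I f UNIV] assms by auto

lemma polyfun_mult_eq_0:
  assumes "polyfun f" "polyfun g" "\<And>x. f x * g x = 0" "f a \<noteq> 0"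
  shows "g b = 0"
  using common_nonzero_UNIV[of "{True, False}" "\<lambda>k. if k then f else g"] assms
  by fastforce


section \<open>Products of affine functions\<close>

text \<open>The difference \<open>l b - l 0\<close> is the linear part of \<open>l\<close>, evaluated at \<open>b\<close>.\<close>

definition nonconst_affine :: "(('v \<Rightarrow> complex) \<Rightarrow> complex) \<Rightarrow> bool" where
  "nonconst_affine l \<longleftrightarrow> polyfun l \<and> (\<exists>d. l d \<noteq> l (\<lambda>_. 0)) \<and>
     (\<forall>a b t. l (\<lambda>i. a i + t * b i) = l a + t * (l b - l (\<lambda>_. 0)))"

text \<open>The projection onto the hyperplane \<open>l = 0\<close> along the direction \<open>d\<close>, which must not be parallel
  to it.\<close>

definition proj :: "(('v \<Rightarrow> complex) \<Rightarrow> complex) \<Rightarrow> ('v \<Rightarrow> complex) \<Rightarrow> ('v \<Rightarrow> complex) \<Rightarrow> 'v \<Rightarrow> complex"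
  where "proj l d x = (\<lambda>i. x i + (- l x / (l d - l (\<lambda>_. 0))) * d i)"

lemma proj_zero:
  assumes "nonconst_affine l" "l d \<noteq> l (\<lambda>_. 0)"
  shows "l (proj l d x) = 0"
proof -
  have "l (proj l d x) = l x + (- l x / (l d - l (\<lambda>_. 0))) * (l d - l (\<lambda>_. 0))"
    unfolding proj_def using assms(1) unfolding nonconst_affine_def by blast
  then show ?thesis using assms(2) by simp
qed

lemma proj_id: "l x = 0 \<Longrightarrow> proj l d x = x"
  by (simp add: proj_def)

lemma polyfun_proj: "polyfun l \<Longrightarrow> polyfun (\<lambda>x. proj l d x i)"
  by (simp add: proj_def)

text \<open>Moving a point by a multiple of \<open>l\<close> changes every polynomial by a multiple of \<open>l\<close>: this is clear
  for coordinates and passes to sums and products. Since the projected point lies on the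
  hyperplane, where \<open>f\<close> vanishes, the change is \<open>f\<close> itself.\<close>

lemma divide_affine:
  assumes l: "nonconst_affine l" and f: "polyfun f" and van: "\<And>x. l x = 0 \<Longrightarrow> f x = 0"
  shows "\<exists>g. polyfun g \<and> (\<forall>x. f x = l x * g x)"
proof -
  from l obtain d where d: "l d \<noteq> l (\<lambda>_. 0)" by (auto simp: nonconst_affine_def)
  have pl: "polyfun l" using l by (simp add: nonconst_affine_def)
  have "\<exists>g. polyfun g \<and> (\<forall>x. f x - f (proj l d x) = l x * g x)"
    using f
  proof induction
    case (const c)
    show ?case by (intro exI[of _ "\<lambda>_. 0"]) auto
  next
    case (coord i)
    show ?case
      by (intro exI[of _ "\<lambda>_. d i / (l d - l (\<lambda>_. 0))"]) (auto simp: proj_def)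
  next
    case (add f g)
    from add.IH(1) obtain f' where f': "polyfun f'" "\<forall>x. f x - f (proj l d x) = l x * f' x"
      by (elim exE conjE)
    from add.IH(2) obtain g' where g': "polyfun g'" "\<forall>x. g x - g (proj l d x) = l x * g' x"
      by (elim exE conjE)
    have "f x + g x - (f (proj l d x) + g (proj l d x)) = l x * (f' x + g' x)" for x
      using f'(2)[rule_format, of x] g'(2)[rule_format, of x] by (simp add: algebra_simps)
    with f'(1) g'(1) show ?case
      by (intro exI[of _ "\<lambda>x. f' x + g' x"] conjI allI polyfun.add)
  next
    case (mult f g)
    from mult.IH(1) obtain f' where f': "polyfun f'" "\<forall>x. f x - f (proj l d x) = l x * f' x"
      by (elim exE conjE)
    from mult.IH(2) obtain g' where g': "polyfun g'" "\<forall>x. g x - g (proj l d x) = l x * g' x"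
      by (elim exE conjE)
    have "f x * g x - f (proj l d x) * g (proj l d x) =
        l x * (f' x * g x + f (proj l d x) * g' x)" for x
    proof -
      have "f x * g x - f (proj l d x) * g (proj l d x) =
        (f x - f (proj l d x)) * g x + f (proj l d x) * (g x - g (proj l d x))"
        by (simp add: algebra_simps)
      then show ?thesis by (simp only: f'(2)[rule_format] g'(2)[rule_format]) (simp add: algebra_simps)
    qed
    moreover have "polyfun (\<lambda>x. f (proj l d x))"
      by (rule polyfun_compose[OF mult.hyps(1) polyfun_proj[OF pl]])
    ultimately show ?case using f'(1) g'(1) mult.hyps
      by (intro exI[of _ "\<lambda>x. f' x * g x + f (proj l d x) * g' x"] conjI allI) simp_all
  qed
  with van proj_zero[OF l d] show ?thesis by simp
qed

text \<open>This replaces the Nullstellensatz. On a line in a fixed direction \<open>d\<close>, transversal to all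
  hyperplanes, the zeros of \<open>p\<close> can only be the points where the line meets the hyperplanes, that is,
  the projections of \<open>a\<close> along \<open>d\<close>. If \<open>p\<close> vanishes identically on no hyperplane, then for generic \<open>a\<close>
  it is nonzero at all these points; thus \<open>p\<close> has no zero on the line and is
  constant there by the fundamental theorem of algebra. As \<open>a\<close> and \<open>d\<close> are generic,
  \<open>p\<close> is constant.\<close>

lemma const_or_vanishes:
  assumes "finite L" "\<And>l. l \<in> L \<Longrightarrow> nonconst_affine l" and p: "polyfun p"
    and cover: "\<And>x. p x = 0 \<Longrightarrow> \<exists>l\<in>L. l x = 0"
    and nv: "\<And>l. l \<in> L \<Longrightarrow> \<exists>x. l x = 0 \<and> p x \<noteq> 0"
  shows "p x = p y"
proof -
  have pl: "polyfun l" if "l \<in> L" for l using assms(2) that by (simp add: nonconst_affine_def)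
  have shift: "p (\<lambda>i. a i + d i) = p a" if d: "\<forall>l\<in>L. l d \<noteq> l (\<lambda>_. 0)" for a d
  proof -
    have generic: "p (\<lambda>i. a i + d i) = p a" if a: "\<forall>l\<in>L. p (proj l d a) \<noteq> 0" for a
    proof -
      obtain P where P: "\<And>t. p (\<lambda>i. a i + t * d i) = poly P t" using polyfun_on_line[OF p, of a d] by blast
      have "poly P t \<noteq> 0" for t
      proof
        assume "poly P t = 0"
        with P cover obtain l where l: "l \<in> L" "l (\<lambda>i. a i + t * d i) = 0" by metis
        then have "l a + t * (l d - l (\<lambda>_. 0)) = 0"
          using assms(2) unfolding nonconst_affine_def by metis
        with d l(1) have "t = - l a / (l d - l (\<lambda>_. 0))"
          by (simp add: field_simps add_eq_0_iff)
        then have "(\<lambda>i. a i + t * d i) = proj l d a" by (simp add: proj_def)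
        with a l P \<open>poly P t = 0\<close> show False by metis
      qed
      then have "degree P = 0"
        by (metis constant_degree fundamental_theorem_of_algebra)
      then show ?thesis using P[of 0] P[of 1] by (auto elim!: degree_eq_zeroE)
    qed
    have "\<exists>a. \<forall>l\<in>L. p (proj l d a) \<noteq> 0"
    proof (rule common_nonzero_UNIV)
      show "polyfun (\<lambda>a. p (proj l d a))" if "l \<in> L" for l
        using p polyfun_proj[OF pl[OF that]] by (rule polyfun_compose)
      show "\<exists>a. p (proj l d a) \<noteq> 0" if "l \<in> L" for l
        using nv[OF that] proj_id[of l] by metis
    qed fact
    then obtain a0 where a0: "(\<Prod>l\<in>L. p (proj l d a0)) \<noteq> 0"
      using \<open>finite L\<close> by auto
    have "p (\<lambda>i. a i + d i) - p a = 0"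
    proof (rule polyfun_mult_eq_0[where f = "\<lambda>a. \<Prod>l\<in>L. p (proj l d a)"
          and g = "\<lambda>a. p (\<lambda>i. a i + d i) - p a"])
      show "polyfun (\<lambda>a. \<Prod>l\<in>L. p (proj l d a))"
        by (intro polyfun_prod polyfun_compose[OF p polyfun_proj] pl)
      have "polyfun (\<lambda>a. p (\<lambda>i. a i + d i))"
        by (rule polyfun_compose[OF p]) simp
      with p show "polyfun (\<lambda>a. p (\<lambda>i. a i + d i) - p a)" by simp
      show "(\<Prod>l\<in>L. p (proj l d a)) * (p (\<lambda>i. a i + d i) - p a) = 0" for a
        using generic[of a] \<open>finite L\<close> by auto
    qed (fact a0)
    then show ?thesis by simp
  qed
  have "\<exists>d. \<forall>l\<in>L. l d - l (\<lambda>_. 0) \<noteq> 0"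
    using assms(1,2) by (intro common_nonzero_UNIV) (auto simp: nonconst_affine_def)
  then obtain d0 where d0: "(\<Prod>l\<in>L. l d0 - l (\<lambda>_. 0)) \<noteq> 0"
    using \<open>finite L\<close> by auto
  have "p (\<lambda>i. x i + (\<lambda>i. y i - x i) i) - p x = 0"
  proof (rule polyfun_mult_eq_0[where f = "\<lambda>d. \<Prod>l\<in>L. l d - l (\<lambda>_. 0)"
        and g = "\<lambda>d. p (\<lambda>i. x i + d i) - p x"])
    show "polyfun (\<lambda>d. \<Prod>l\<in>L. l d - l (\<lambda>_. 0))"
      using pl by auto
    have "polyfun (\<lambda>d. p (\<lambda>i. x i + d i))"
      by (rule polyfun_compose[OF p]) simp
    then show "polyfun (\<lambda>d. p (\<lambda>i. x i + d i) - p x)" by simp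
    show "(\<Prod>l\<in>L. l d - l (\<lambda>_. 0)) * (p (\<lambda>i. x i + d i) - p x) = 0" for d
      using shift[of d] \<open>finite L\<close> by auto
  qed (fact d0)
  then show ?thesis by simp
qed

text \<open>On a line transversal to the hyperplanes \<open>l = 0\<close> every factor \<open>l\<close> contributes a root, and the number
  of roots is bounded by the degree of \<open>p\<close>.\<close>

lemma affine_factors_bounded:
  assumes p: "polyfun p" and "p a \<noteq> 0"
  shows "\<exists>d. \<forall>ls r. (\<forall>l\<in>set ls. nonconst_affine l) \<and> polyfun r \<and>
    (\<forall>x. p x = (\<Prod>l\<leftarrow>ls. l x) * r x) \<longrightarrow> length ls \<le> d"
proof -
  obtain d where d: "\<And>a b. \<exists>P. degree P \<le> d \<and> (\<forall>t. p (\<lambda>i. a i + t * b i) = poly P t)"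
    using polyfun_on_lines[OF p] by blast
  show ?thesis
  proof (intro exI[of _ d] allI impI, elim conjE)
    fix ls :: "(('a \<Rightarrow> complex) \<Rightarrow> complex) list" and r
    assume ls: "\<forall>l\<in>set ls. nonconst_affine l" and r: "polyfun r"
      and p: "\<forall>x. p x = (\<Prod>l\<leftarrow>ls. l x) * r x"
    have "\<exists>b. \<forall>l\<in>set ls. l b - l (\<lambda>_. 0) \<noteq> 0"
      using ls by (intro common_nonzero_UNIV) (auto simp: nonconst_affine_def)
    then obtain b where b: "\<forall>l\<in>set ls. l b - l (\<lambda>_. 0) \<noteq> 0" by blast
    obtain P where P: "degree P \<le> d" "\<And>t. p (\<lambda>i. a i + t * b i) = poly P t"
      using d by blast
    obtain R where R: "\<And>t. r (\<lambda>i. a i + t * b i) = poly R t" using polyfun_on_line[OF r, of a b] by blast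
    let ?Q = "\<lambda>ls. \<Prod>l\<leftarrow>ls. [:l a, l b - l (\<lambda>_. 0):]"
    have "poly P t = poly (?Q ls * R) t" for t
    proof -
      have "(\<Prod>l\<leftarrow>ls. l (\<lambda>i. a i + t * b i)) = poly (?Q ls) t"
      proof -
        have "l (\<lambda>i. a i + t * b i) = poly [:l a, l b - l (\<lambda>_. 0):] t" if "l \<in> set ls" for l
          using ls that unfolding nonconst_affine_def by simp
        then show ?thesis by (induction ls) (simp_all del: poly_pCons mult_pCons_left)
      qed
      then show ?thesis using P(2)[of t] p R by simp
    qed
    then have PQ: "P = ?Q ls * R" by (auto simp: poly_eq_poly_eq_iff[symmetric])
    have "P \<noteq> 0" using P(2)[of 0] \<open>p a \<noteq> 0\<close> by auto
    have "degree (?Q ls) = length ls \<and> ?Q ls \<noteq> 0"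
      using b by (induction ls) (simp_all add: degree_mult_eq del: mult_pCons_left)
    then show "length ls \<le> d"
      using PQ \<open>P \<noteq> 0\<close> P(1) by (auto simp: degree_mult_eq)
  qed
qed

text \<open>Factors from \<open>L\<close> are split off as long as the cofactor vanishes on one of the hyperplanes; the
  bound on their number makes this end, even if \<open>L\<close> is infinite.\<close>

lemma polyfun_maximal_affine_factor:
  assumes p: "polyfun p" and "p a \<noteq> 0" and L: "\<And>l. l \<in> L \<Longrightarrow> nonconst_affine l"
  shows "\<exists>ls r. set ls \<subseteq> L \<and> polyfun r \<and> (\<forall>x. p x = (\<Prod>l\<leftarrow>ls. l x) * r x) \<and>
    (\<forall>l\<in>L. \<exists>x. l x = 0 \<and> r x \<noteq> 0)"
proof -
  define P where "P ls \<longleftrightarrow> set ls \<subseteq> L \<and> (\<exists>r. polyfun r \<and> (\<forall>x. p x = (\<Prod>l\<leftarrow>ls. l x) * r x))" for ls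
  obtain d where d: "\<forall>ls r. (\<forall>l\<in>set ls. nonconst_affine l) \<and> polyfun r \<and>
    (\<forall>x. p x = (\<Prod>l\<leftarrow>ls. l x) * r x) \<longrightarrow> length ls \<le> d"
    using affine_factors_bounded[OF p \<open>p a \<noteq> 0\<close>] by (rule exE)
  have "length ls \<le> d" if "P ls" for ls
  proof -
    from that obtain r where "set ls \<subseteq> L" "polyfun r" "\<forall>x. p x = (\<Prod>l\<leftarrow>ls. l x) * r x"
      unfolding P_def by blast
    with d[rule_format, of ls r] L show ?thesis by (meson subsetD)
  qed
  moreover have "P []" using p unfolding P_def by (intro conjI exI[of _ p]) auto
  ultimately obtain ls where ls: "P ls" "\<forall>ls'. P ls' \<longrightarrow> length ls' \<le> length ls"
    using Lattices_Big.ex_has_greatest_nat[of P "[]" length "Suc d"] by (auto simp: less_Suc_eq_le)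
  then obtain r where r: "polyfun r" "\<forall>x. p x = (\<Prod>l\<leftarrow>ls. l x) * r x"
    by (auto simp: P_def)
  have nv: "\<exists>x. l x = 0 \<and> r x \<noteq> 0" if "l \<in> L" for l
  proof (rule ccontr)
    assume "\<not> ?thesis"
    then have "\<exists>g. polyfun g \<and> (\<forall>x. r x = l x * g x)"
      by (intro divide_affine[OF L[OF that] r(1)]) blast
    then obtain g where g: "polyfun g" "\<forall>x. r x = l x * g x" by (elim exE conjE)
    then have "P (l # ls)" using ls(1) that r(2) unfolding P_def
      by (intro conjI exI[of _ g]) (auto simp: mult_ac)
    with ls(2) show False by fastforce
  qed
  show ?thesis
  proof (rule exI[of _ ls], rule exI[of _ r], intro conjI ballI)
    show "set ls \<subseteq> L" using ls(1) unfolding P_def by (rule conjunct1)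
  qed (fact r nv)+
qed

text \<open>What remains after splitting off a maximal product of affine factors vanishes on none of the
  hyperplanes, so it is constant.\<close>

lemma product_of_affine_finite:
  assumes p: "polyfun p" and "p a \<noteq> 0" and L: "\<And>l. l \<in> L \<Longrightarrow> nonconst_affine l"
    and "finite L" and cover: "\<And>x. p x = 0 \<Longrightarrow> \<exists>l\<in>L. l x = 0"
  shows "\<exists>ls c. set ls \<subseteq> L \<and> c \<noteq> 0 \<and> (\<forall>x. p x = (\<Prod>l\<leftarrow>ls. l x) * c)"
proof -
  have "\<exists>ls r. set ls \<subseteq> L \<and> polyfun r \<and> (\<forall>x. p x = (\<Prod>l\<leftarrow>ls. l x) * r x) \<and>
    (\<forall>l\<in>L. \<exists>x. l x = 0 \<and> r x \<noteq> 0)"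
    using p \<open>p a \<noteq> 0\<close> L by (rule polyfun_maximal_affine_factor)
  then obtain ls r where ls: "set ls \<subseteq> L" "polyfun r" "\<forall>x. p x = (\<Prod>l\<leftarrow>ls. l x) * r x"
    and nv: "\<forall>l\<in>L. \<exists>x. l x = 0 \<and> r x \<noteq> 0"
    by (elim exE conjE)
  have "r x = r a" for x
  proof (rule const_or_vanishes[OF \<open>finite L\<close> L ls(2)])
    show "\<exists>l\<in>L. l x = 0" if "r x = 0" for x
      using cover[of x] ls(3) that by simp
  qed (use nv in auto)
  then have r: "\<forall>x. p x = (\<Prod>l\<leftarrow>ls. l x) * r a" using ls(3) by simp
  show ?thesis
  proof (rule exI[of _ ls], rule exI[of _ "r a"], intro conjI)
    show "r a \<noteq> 0" using ls(3)[rule_format, of a] \<open>p a \<noteq> 0\<close> by auto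
  qed (fact ls(1) r)+
qed

text \<open>A hyperplane contained in the zeros of \<open>p = l\<^sub>1 \<dots> l\<^sub>k r\<close>, but not in those of \<open>r\<close>, is contained in
  one of the hyperplanes \<open>l\<^sub>i = 0\<close> because it is irreducible. Therefore finitely many of the given
  hyperplanes already cover the zeros of \<open>p\<close>.\<close>

lemma product_of_affine:
  assumes p: "polyfun p" and "p a \<noteq> 0" and L: "\<And>l. l \<in> L \<Longrightarrow> nonconst_affine l"
    and zeros: "\<And>x. p x = 0 \<longleftrightarrow> (\<exists>l\<in>L. l x = 0)"
  shows "\<exists>ls c. set ls \<subseteq> L \<and> c \<noteq> 0 \<and> (\<forall>x. p x = (\<Prod>l\<leftarrow>ls. l x) * c)"
proof -
  have "\<exists>ls r. set ls \<subseteq> L \<and> polyfun r \<and> (\<forall>x. p x = (\<Prod>l\<leftarrow>ls. l x) * r x) \<and>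
    (\<forall>l\<in>L. \<exists>x. l x = 0 \<and> r x \<noteq> 0)"
    using p \<open>p a \<noteq> 0\<close> L by (rule polyfun_maximal_affine_factor)
  then obtain ls r where ls: "set ls \<subseteq> L" "polyfun r" "\<forall>x. p x = (\<Prod>l\<leftarrow>ls. l x) * r x"
    and nv: "\<forall>l\<in>L. \<exists>x. l x = 0 \<and> r x \<noteq> 0"
    by (elim exE conjE)
  have sub: "\<exists>l'\<in>set ls. \<forall>x. l x = 0 \<longrightarrow> l' x = 0" if "l \<in> L" for l
  proof (rule ccontr)
    assume *: "\<not> ?thesis"
    have "\<exists>x\<in>{x. l x = 0}. \<forall>f\<in>insert r (set ls). f x \<noteq> 0"
    proof (rule common_nonzero)
      show "polyfun f" if "f \<in> insert r (set ls)" for f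
        using that ls(1,2) L by (auto simp: nonconst_affine_def)
      show "\<exists>x\<in>{x. l x = 0}. f x \<noteq> 0" if "f \<in> insert r (set ls)" for f
        using that * nv \<open>l \<in> L\<close> by auto
      show "{x. l x = 0} \<noteq> {}" using nv \<open>l \<in> L\<close> by auto
      show "(\<lambda>i. a i + t * (b i - a i)) \<in> {x. l x = 0}" if "a \<in> {x. l x = 0}" "b \<in> {x. l x = 0}"
        for a b t
      proof -
        have aff: "l (\<lambda>i. a i + t * b i) = l a + t * (l b - l (\<lambda>_. 0))" for a b t
          using L[OF \<open>l \<in> L\<close>] by (auto simp: nonconst_affine_def)
        have "l (\<lambda>i. b i + (-1) * a i) = l b - (l a - l (\<lambda>_. 0))"
          by (subst aff) simp
        then show ?thesis using that aff[of a t "\<lambda>i. b i + (-1) * a i"] by simp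
      qed
    qed simp
    then obtain x where x: "l x = 0" "r x \<noteq> 0" "\<forall>f\<in>set ls. f x \<noteq> 0" by auto
    then have "p x \<noteq> 0" using ls(3) by (auto simp: prod_list_zero_iff)
    with x(1) zeros \<open>l \<in> L\<close> show False by auto
  qed
  have cover: "\<exists>l\<in>set ls. l x = 0" if "p x = 0" for x
    using that zeros[of x] sub by auto
  have "\<exists>ls' c. set ls' \<subseteq> set ls \<and> c \<noteq> 0 \<and> (\<forall>x. p x = (\<Prod>l\<leftarrow>ls'. l x) * c)"
  proof (rule product_of_affine_finite[OF p \<open>p a \<noteq> 0\<close>])
    show "nonconst_affine l" if "l \<in> set ls" for l using that ls(1) L by auto
  qed (use cover in auto)
  then obtain ls' c where ls': "set ls' \<subseteq> set ls" "c \<noteq> 0" "\<forall>x. p x = (\<Prod>l\<leftarrow>ls'. l x) * c"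
    by (elim exE conjE)
  show ?thesis
  proof (rule exI[of _ ls'], rule exI[of _ c], intro conjI)
    show "set ls' \<subseteq> L" using ls'(1) ls(1) by simp
  qed (fact ls')+
qed

section \<open>Affine forms of black boxes and their varieties\<close>

lemma monomial_degree_le_1:
  assumes "(\<Sum>i\<in>keys m. lookup m i) \<le> (1::nat)"
  shows "m = 0 \<or> (\<exists>i. m = Poly_Mapping.single i 1)"
proof (cases "keys m = {}")
  case False
  then obtain i where i: "i \<in> keys m" by blast
  have "(\<Sum>j\<in>keys m. lookup m j) = lookup m i + (\<Sum>j\<in>keys m - {i}. lookup m j)"
    using i by (simp add: sum.remove)
  moreover have "lookup m i \<noteq> 0" using i by (simp add: in_keys_iff)
  ultimately have 1: "lookup m i = 1" and "(\<Sum>j\<in>keys m - {i}. lookup m j) = 0"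
    using assms by linarith+
  then have *: "\<forall>j\<in>keys m - {i}. lookup m j = 0" by simp
  have 0: "lookup m j = 0" if "j \<noteq> i" for j
    using that *[rule_format, of j] by (cases "j \<in> keys m") (simp_all add: in_keys_iff)
  have "m = Poly_Mapping.single i 1"
    by (rule poly_mapping_eqI) (use 0 1 in \<open>auto simp: lookup_single when_def\<close>)
  then show ?thesis by blast
qed simp

lemma affine_poly_eval:
  fixes p :: "nat cpoly" and k :: nat
  assumes "affine_poly p" "vars p \<subseteq> {..<k}"
  obtains c0 c where "\<And>y. peval y p = c0 + (\<Sum>r<k. c r * y r)"
proof
  fix y :: "nat \<Rightarrow> complex"
  let ?e = "\<lambda>r::nat. Poly_Mapping.single r (1::nat)"
  have "keys p \<subseteq> insert 0 (?e ` {..<k})"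
  proof
    fix m assume m: "m \<in> keys p"
    then consider "m = 0" | i where "m = ?e i"
      using assms(1) monomial_degree_le_1[of m] unfolding affine_poly_def by blast
    then show "m \<in> insert 0 (?e ` {..<k})"
    proof cases
      case 2
      then have "i \<in> vars p" using m by (auto simp: vars_def intro!: bexI[of _ m])
      then show ?thesis using 2 assms(2) by auto
    qed simp
  qed
  then have "peval y p = (\<Sum>m\<in>insert 0 (?e ` {..<k}). lookup p m * mon y m)"
    by (intro peval_superset) auto
  also have "\<dots> = lookup p 0 + (\<Sum>m\<in>?e ` {..<k}. lookup p m * mon y m)"
    by (subst sum.insert) (auto simp: single_zero dest!: arg_cong[of _ _ keys])
  also have "(\<Sum>m\<in>?e ` {..<k}. lookup p m * mon y m) = (\<Sum>r<k. lookup p (?e r) * y r)"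
    by (subst sum.reindex) (auto simp: inj_on_def dest!: arg_cong[of _ _ keys])
  finally show "peval y p = lookup p 0 + (\<Sum>r<k. lookup p (?e r) * y r)" .
qed

lemma affine_poly_line:
  fixes p :: "nat cpoly" and k :: nat
  assumes "affine_poly p" "vars p \<subseteq> {..<k}"
  shows "peval (\<lambda>r. a r + t * b r) p = peval a p + t * (peval b p - peval (\<lambda>_. 0) p)"
proof -
  obtain c0 c where "\<And>y. peval y p = c0 + (\<Sum>r<k. c r * y r)"
    using affine_poly_eval[OF assms] by blast
  then show ?thesis by (simp add: ring_distribs sum.distrib sum_distrib_left mult_ac)
qed

text \<open>The signs \<open>\<sigma>\<close> are 0, 1 or \<open>-1\<close>, where 0 stands for an argument that is set to 0. The arguments
  may be named by the same variable.\<close>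

definition form :: "nat cpoly \<Rightarrow> (nat \<Rightarrow> complex) \<Rightarrow> (nat \<Rightarrow> 'n) \<Rightarrow> ('n \<Rightarrow> complex) \<Rightarrow> complex" where
  "form p \<sigma> s x = peval (\<lambda>r. \<sigma> r * x (s r)) p"

definition forms :: "'j set \<Rightarrow> ('j \<Rightarrow> nat cpoly) \<Rightarrow> (('n \<Rightarrow> complex) \<Rightarrow> complex) set" where
  "forms K q = {form (q j) \<sigma> s | j \<sigma> s. j \<in> K \<and> (\<forall>r. \<sigma> r \<in> {0, 1, -1})}"

lemma finite_forms:
  fixes q :: "'j \<Rightarrow> nat cpoly" and ar :: "'j \<Rightarrow> nat"
  assumes "finite K" "\<And>j. j \<in> K \<Longrightarrow> vars (q j) \<subseteq> {..<ar j}"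
  shows "finite (forms K q :: (('n::finite \<Rightarrow> complex) \<Rightarrow> complex) set)"
proof (rule finite_subset)
  let ?A = "\<lambda>j. PiE {..<ar j} (\<lambda>_. {0, 1, -1}) \<times> PiE {..<ar j} (\<lambda>_. UNIV :: 'n set)"
  show "finite (\<Union>j\<in>K. (\<lambda>(\<sigma>, s). form (q j) \<sigma> s) ` ?A j)"
    using assms(1) by (intro finite_UN_I finite_imageI finite_cartesian_product finite_PiE) auto
  show "forms K q \<subseteq> (\<Union>j\<in>K. (\<lambda>(\<sigma>, s). form (q j) \<sigma> s) ` ?A j)"
  proof
    fix l :: "('n \<Rightarrow> complex) \<Rightarrow> complex" assume "l \<in> forms K q"
    then obtain j \<sigma> and s :: "nat \<Rightarrow> 'n"
      where l: "l = form (q j) \<sigma> s" "j \<in> K" "\<forall>r. \<sigma> r \<in> {0, 1, -1}"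
      unfolding forms_def by blast
    have "l = form (q j) (restrict \<sigma> {..<ar j}) (restrict s {..<ar j})"
      unfolding l(1) form_def using assms(2)[OF l(2)]
      by (intro ext peval_cong) auto
    moreover have "(restrict \<sigma> {..<ar j}, restrict s {..<ar j}) \<in> ?A j"
      using l(3) by (auto simp: PiE_iff)
    ultimately show "l \<in> (\<Union>j\<in>K. (\<lambda>(\<sigma>, s). form (q j) \<sigma> s) ` ?A j)"
      using l(2) by blast
  qed
qed

lemma form_cases:
  assumes "affine_poly p" "vars p \<subseteq> {..<k}"
  shows "(\<forall>x. form p \<sigma> s x = form p \<sigma> s (\<lambda>_. 0)) \<or> nonconst_affine (form p \<sigma> s)"
proof -
  have "form p \<sigma> s (\<lambda>i. a i + t * b i) =
      form p \<sigma> s a + t * (form p \<sigma> s b - form p \<sigma> s (\<lambda>_. 0))" for a b t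
    using affine_poly_line[OF assms, of "\<lambda>r. \<sigma> r * a (s r)" t "\<lambda>r. \<sigma> r * b (s r)"]
    by (simp add: form_def algebra_simps)
  moreover have "polyfun (form p \<sigma> s)"
    unfolding form_def[abs_def] by (rule polyfun_peval) simp
  ultimately show ?thesis unfolding nonconst_affine_def by blast
qed

lemma lookup_restrict_mono:
  "lookup (restrict_mono T m) i = (if i \<in> T then lookup m i else 0)"
  by (auto simp: restrict_mono_def lookup_mapp when_def in_keys_iff)

lemma mon_restrict:
  "mon z m = mon z (restrict_mono T m) * mon z (restrict_mono (- T) m)"
proof -
  have "m = restrict_mono T m + restrict_mono (- T) m"
    by (rule poly_mapping_eqI) (simp add: lookup_add lookup_restrict_mono)
  then show ?thesis by (metis mon_add)
qed

lemma mon_restrict_cong: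
  assumes "\<And>i. i \<in> T \<Longrightarrow> z i = y i"
  shows "mon z (restrict_mono T m) = mon y (restrict_mono T m)"
  unfolding mon_def using assms
  by (intro prod.cong) (auto simp: in_keys_iff lookup_restrict_mono split: if_splits)

lemma peval_coeff_in:
  "peval y (coeff_in T \<alpha> p) =
    (\<Sum>m\<in>{m \<in> keys p. restrict_mono T m = \<alpha>}. lookup p m * mon y (restrict_mono (- T) m))"
  by (simp add: coeff_in_def)

lemma coeff_in_expansion:
  "peval z p = (\<Sum>\<alpha>\<in>restrict_mono T ` keys p. peval z (coeff_in T \<alpha> p) * mon z \<alpha>)"
proof -
  have "peval z p = (\<Sum>\<alpha>\<in>restrict_mono T ` keys p.
      \<Sum>m\<in>{m \<in> keys p. restrict_mono T m = \<alpha>}. lookup p m * mon z m)"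
    unfolding peval_mon by (rule sum.image_gen) simp
  also have "\<dots> = (\<Sum>\<alpha>\<in>restrict_mono T ` keys p. peval z (coeff_in T \<alpha> p) * mon z \<alpha>)"
    unfolding peval_coeff_in sum_distrib_right
    by (intro sum.cong refl, subst mon_restrict[of z _ T]) auto
  finally show ?thesis .
qed

text \<open>Monomials in \<open>T\<close> are linearly independent, so the coefficients are 0 if and only if their combination
  with every choice of the coordinates in \<open>T\<close> is 0. This makes it possible to handle the varieties
  without their coefficients.\<close>

lemma coeff_in_vanish_iff:
  "(\<forall>\<alpha>. peval y (coeff_in T \<alpha> p) = 0) \<longleftrightarrow>
   (\<forall>z. (\<forall>i. i \<notin> T \<longrightarrow> z i = y i) \<longrightarrow> peval z p = 0)"
proof (intro iffI allI impI)
  have off: "peval z (coeff_in T \<alpha> p) = peval y (coeff_in T \<alpha> p)"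
    if "\<forall>i. i \<notin> T \<longrightarrow> z i = y i" for z \<alpha>
    unfolding peval_coeff_in using that
    by (intro sum.cong refl arg_cong2[where f = "(*)"] mon_restrict_cong) auto
  {
    fix z assume "\<forall>\<alpha>. peval y (coeff_in T \<alpha> p) = 0" "\<forall>i. i \<notin> T \<longrightarrow> z i = y i"
    then show "peval z p = 0"
      using coeff_in_expansion[of z p T] off[of z] by simp
  }
  fix \<alpha> assume *: "\<forall>z. (\<forall>i. i \<notin> T \<longrightarrow> z i = y i) \<longrightarrow> peval z p = 0"
  show "peval y (coeff_in T \<alpha> p) = 0"
  proof (cases "\<alpha> \<in> restrict_mono T ` keys p")
    case True
    have "(\<Sum>\<alpha>\<in>restrict_mono T ` keys p. peval y (coeff_in T \<alpha> p) * mon x \<alpha>) = 0" for x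
    proof -
      define z where "z = (\<lambda>i. if i \<in> T then x i else y i)"
      have z: "\<forall>i. i \<notin> T \<longrightarrow> z i = y i" by (simp add: z_def)
      have "mon z \<alpha> = mon x \<alpha>" if "\<alpha> \<in> restrict_mono T ` keys p" for \<alpha>
        using that by (auto intro: mon_restrict_cong simp: z_def)
      then show ?thesis
        using * z coeff_in_expansion[of z p T] off[OF z] by simp
    qed
    from mon_independent[OF _ this True] show ?thesis by simp
  next
    case False
    then have "{m \<in> keys p. restrict_mono T m = \<alpha>} = {}" by auto
    then show ?thesis by (simp only: peval_coeff_in sum.empty)
  qed
qed

definition rewrite_sign :: "(nat \<Rightarrow> complex) set \<Rightarrow> nat \<Rightarrow> complex" where
  "rewrite_sign L i = (if \<forall>y\<in>L. y i = 0 then 0 else if \<forall>y\<in>L. y i = y (rep L i) then 1 else - 1)"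

lemma peval_rewrite_var: "peval z (rewrite_var L i) = rewrite_sign L i * z (rep L i)"
  by (simp add: rewrite_var_def rewrite_sign_def)

definition negation_sign :: "nat set \<Rightarrow> nat \<Rightarrow> complex" where
  "negation_sign N i = (if i \<in> N then - 1 else 1)"

lemma mem_V_I_iff:
  "y \<in> V_I T KZ KD KS KN p \<longleftrightarrow>
    (\<forall>z. (\<forall>i. i \<notin> T \<longrightarrow> z i = negation_sign KN i * y i) \<longrightarrow>
      peval (\<lambda>r. rewrite_sign (cond_space KZ KD KS) r * z (rep (cond_space KZ KD KS) r)) p = 0)"
proof -
  have "(\<lambda>i. if i \<in> KN then - y i else y i) = (\<lambda>i. negation_sign KN i * y i)"
    by (auto simp: negation_sign_def)
  then show ?thesis
    unfolding V_I_def V_TZDS_def mem_Collect_eq INT_iff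
    by (simp only: UNIV_I simp_thms ball_simps coeff_in_vanish_iff peval_psubst peval_rewrite_var)
qed

text \<open>Arguments that are 0 are put into \<open>K\<^sub>Z\<close> and negated ones into \<open>K\<^sub>N\<close>. Equal arguments need no
  identification since \<open>s\<close> may give them the same name.\<close>

lemma form_zeros_variety:
  fixes s :: "nat \<Rightarrow> 'n::finite"
  assumes vars: "vars p \<subseteq> {..<k}" and sign: "\<forall>r. \<sigma> r \<in> {0, 1, -1}"
  shows "{x :: complex ^ 'n. form p \<sigma> s (($) x) = 0} \<in> black_box_varieties k p"
proof -
  define KZ where "KZ = {r. r < k \<and> \<sigma> r = 0}"
  define KN where "KN = {r. r < k \<and> \<sigma> r = -1}"
  let ?L = "cond_space KZ {} {}"
  have mem: "(\<lambda>i. if i = r then 1 else 0) \<in> ?L" if "r \<notin> KZ" for r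
    using that by (auto simp: cond_space_def)
  have rep: "rep ?L r = r" if "r \<notin> KZ" for r
    unfolding rep_def
  proof (rule Least_equality)
    fix r' assume "(\<forall>y\<in>?L. y r = y r') \<or> (\<forall>y\<in>?L. y r = - y r')"
    with mem[OF that] have "r' = r" by (auto split: if_splits)
    then show "r \<le> r'" by simp
  qed simp
  have zero: "(\<forall>y\<in>?L. y r = 0) \<longleftrightarrow> r \<in> KZ" for r
  proof
    assume *: "\<forall>y\<in>?L. y r = 0"
    show "r \<in> KZ"
    proof (rule ccontr)
      assume "r \<notin> KZ"
      with *[rule_format, OF mem[of r]] show False by simp
    qed
  qed (auto simp: cond_space_def)
  have sgn: "rewrite_sign ?L r = (if r \<in> KZ then 0 else 1)" for r
    using zero[of r] rep[of r] by (auto simp: rewrite_sign_def)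
  have rem: "remaining k ?L = {..<k} - KZ"
    using rep by (auto simp: remaining_def zero)
  have adm: "admissible_index k {} KZ {} {} KN"
    unfolding admissible_index_def rem by (auto simp: KZ_def KN_def)
  have "(\<lambda>i. x $ s i) \<in> V_I {} KZ {} {} KN p \<longleftrightarrow> form p \<sigma> s (($) x) = 0" for x
  proof -
    have "peval (\<lambda>r. rewrite_sign ?L r * (negation_sign KN (rep ?L r) * x $ s (rep ?L r))) p =
        form p \<sigma> s (($) x)"
      unfolding form_def
    proof (rule peval_cong)
      fix r assume "r \<in> vars p"
      with vars have "r < k" by auto
      show "rewrite_sign ?L r * (negation_sign KN (rep ?L r) * x $ s (rep ?L r)) = \<sigma> r * x $ s r"
      proof (cases "r \<in> KZ")
        case True
        then have "\<sigma> r = 0" by (simp add: KZ_def)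
        then show ?thesis using sgn[of r] True by simp
      next
        case False
        with \<open>r < k\<close> sign have "negation_sign KN r = \<sigma> r"
          by (auto simp: KZ_def KN_def negation_sign_def)
        then show ?thesis using sgn[of r] rep[OF False] False by simp
      qed
    qed
    then show ?thesis by (simp add: mem_V_I_iff flip: fun_eq_iff)
  qed
  then have "{x. form p \<sigma> s (($) x) = 0} = {x. (\<lambda>i. x $ s i) \<in> V_I {} KZ {} {} KN p}"
    by simp
  with adm show ?thesis unfolding black_box_varieties_def by blast
qed

text \<open>At a point \<open>x\<^sub>0\<close> of the variety the coordinates in \<open>T\<close> can be changed without leaving the zeros of
  the rewritten polynomial. Being affine, it then does not depend on these coordinates anywhere, and
  its zeros form the variety.\<close>

lemma affine_variety_contains_form_zeros:
  fixes x0 :: "complex ^ 'n::finite"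
  assumes aff: "affine_poly p" "vars p \<subseteq> {..<k}"
    and S: "S \<in> black_box_varieties m p" and x0: "x0 \<in> S"
  shows "\<exists>\<sigma> s. (\<forall>r. \<sigma> r \<in> {0, 1, -1}) \<and> form p \<sigma> s (($) x0) = 0 \<and>
    {x. form p \<sigma> s (($) x) = 0} \<subseteq> S"
proof -
  from S obtain s T KZ KD KS KN where
    S: "S = {x. (\<lambda>i. x $ s i) \<in> V_I T KZ KD KS KN p}"
    unfolding black_box_varieties_def by blast
  let ?L = "cond_space KZ KD KS" and ?Y = "\<lambda>x i. negation_sign KN i * x $ s i"
  define G where "G z = peval (\<lambda>r. rewrite_sign ?L r * z (rep ?L r)) p" for z
  have line: "G (\<lambda>i. a i + 1 * b i) = G a + 1 * (G b - G (\<lambda>_. 0))" for a b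
    using affine_poly_line[OF aff, of "\<lambda>r. rewrite_sign ?L r * a (rep ?L r)" 1
        "\<lambda>r. rewrite_sign ?L r * b (rep ?L r)"]
    by (simp add: G_def algebra_simps)
  have S_iff: "x \<in> S \<longleftrightarrow> (\<forall>z. (\<forall>i. i \<notin> T \<longrightarrow> z i = ?Y x i) \<longrightarrow> G z = 0)" for x
    by (simp add: S mem_V_I_iff G_def)
  define \<sigma> where "\<sigma> r = rewrite_sign ?L r * negation_sign KN (rep ?L r)" for r
  define s' where "s' r = s (rep ?L r)" for r
  have form: "form p \<sigma> s' (($) x) = G (?Y x)" for x
    by (simp add: form_def G_def \<sigma>_def s'_def mult_ac)
  show ?thesis
  proof (intro exI[of _ \<sigma>] exI[of _ s'] conjI)
    show "\<forall>r. \<sigma> r \<in> {0, 1, -1}"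
      by (auto simp: \<sigma>_def rewrite_sign_def negation_sign_def)
    show "form p \<sigma> s' (($) x0) = 0" using x0 unfolding form S_iff by simp
    show "{x. form p \<sigma> s' (($) x) = 0} \<subseteq> S"
    proof
      fix x assume "x \<in> {x. form p \<sigma> s' (($) x) = 0}"
      then have x: "G (?Y x) = 0" by (simp add: form)
      show "x \<in> S" unfolding S_iff
      proof (intro allI impI)
        fix z assume z: "\<forall>i. i \<notin> T \<longrightarrow> z i = ?Y x i"
        let ?d = "\<lambda>i. z i - ?Y x i"
        have "G (\<lambda>i. ?Y x0 i + 1 * ?d i) = 0" 
          by (rule x0[unfolded S_iff, rule_format]) (simp add: z)
        moreover have "G (?Y x0) = 0"
          by (rule x0[unfolded S_iff, rule_format]) simp
        ultimately have "G ?d - G (\<lambda>_. 0) = 0" using line[of "?Y x0" ?d] by simp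
        then show "G z = 0" using line[of "?Y x" ?d] x by simp
      qed
    qed
  qed
qed

text \<open>Rewriting turns \<open>x\<^sub>0 x\<^sub>1\<close> into 0 or into a product of two variables up to sign. In the latter case a
  variable outside \<open>T\<close> has to vanish: those in \<open>T\<close> may be set to 1.\<close>

lemma product_variety_contains_hyperplane:
  fixes x0 :: "complex ^ 'n::finite"
  assumes S: "S \<in> black_box_varieties k (Var 0 * Var 1)" and x0: "x0 \<in> S"
  shows "S = UNIV \<or> (\<exists>m. x0 $ m = 0 \<and> {x. x $ m = 0} \<subseteq> S)"
proof -
  from S obtain s T KZ KD KS KN where
    S: "S = {x. (\<lambda>i. x $ s i) \<in> V_I T KZ KD KS KN (Var 0 * Var 1)}"
    unfolding black_box_varieties_def by blast
  let ?L = "cond_space KZ KD KS" and ?Y = "\<lambda>x i. negation_sign KN i * x $ s i"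
  have S_iff: "x \<in> S \<longleftrightarrow> (\<forall>z. (\<forall>i. i \<notin> T \<longrightarrow> z i = ?Y x i) \<longrightarrow>
      (rewrite_sign ?L 0 * z (rep ?L 0)) * (rewrite_sign ?L 1 * z (rep ?L 1)) = 0)" for x
    by (simp add: S mem_V_I_iff)
  show ?thesis
  proof (cases "rewrite_sign ?L 0 = 0 \<or> rewrite_sign ?L 1 = 0")
    case True
    then have "S = UNIV" using S_iff by auto
    then show ?thesis ..
  next
    case False
    \<comment> \<open>The coordinates in \<open>T\<close> are free; at the value 1 they cannot be the factor that vanishes.\<close>
    have "(\<lambda>i. if i \<in> T then 1 else ?Y x0 i) (rep ?L 0) *
        (\<lambda>i. if i \<in> T then 1 else ?Y x0 i) (rep ?L 1) = 0"
      using x0[unfolded S_iff, rule_format, of "\<lambda>i. if i \<in> T then 1 else ?Y x0 i"] False by auto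
    then obtain e where e: "e \<in> {0, 1}" "rep ?L e \<notin> T" "x0 $ s (rep ?L e) = 0"
      by (auto simp: negation_sign_def split: if_splits)
    have "x \<in> S" if "x $ s (rep ?L e) = 0" for x
      unfolding S_iff using e(1,2) that by auto
    with e(3) show ?thesis by blast
  qed
qed

section \<open>Zeros of accurately evaluable polynomials\<close>

text \<open>The value of a node as a function of the input and of the rounding errors.\<close>

type_synonym 'n sval = "('n \<Rightarrow> complex) \<Rightarrow> (nat \<Rightarrow> complex) \<Rightarrow> complex"

fun sfetch :: "(nat \<rightharpoonup> 'n sval) \<Rightarrow> 'n datum \<Rightarrow> 'n sval option" where
  "sfetch M (Input i) = Some (\<lambda>x \<delta>. x i)"
| "sfetch M (Result k) = M k"

text \<open>Execution with such functions in place of numbers. Either successor of a branching node may be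
  taken, whatever the comparison says: arbitrary comparison relations are thereby reduced to the
  fact that an algorithm has only finitely many paths.\<close>

inductive sexec :: "('j \<Rightarrow> nat cpoly) \<Rightarrow> ('j, 'n) algorithm \<Rightarrow> nat \<Rightarrow> (nat \<rightharpoonup> 'n sval)
    \<Rightarrow> 'n sval \<Rightarrow> bool"
  for q :: "'j \<Rightarrow> nat cpoly" and G :: "('j, 'n) algorithm" where
  compute: "i < length G \<Longrightarrow> G ! i = Compute j as k \<Longrightarrow> map (sfetch M) as = map Some vs \<Longrightarrow>
    sexec q G k (M(i \<mapsto> (\<lambda>x \<delta>. peval (\<lambda>r. map (\<lambda>f. f x \<delta>) vs ! r) (q j) * (1 + \<delta> i)))) Y \<Longrightarrow>
    sexec q G i M Y"
| negate: "i < length G \<Longrightarrow> G ! i = Negate a k \<Longrightarrow> sfetch M a = Some f \<Longrightarrow>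
    sexec q G k (M(i \<mapsto> (\<lambda>x \<delta>. - f x \<delta>))) Y \<Longrightarrow> sexec q G i M Y"
| branch_yes: "i < length G \<Longrightarrow> G ! i = Branch R a b k l \<Longrightarrow> sexec q G k M Y \<Longrightarrow> sexec q G i M Y"
| branch_no: "i < length G \<Longrightarrow> G ! i = Branch R a b k l \<Longrightarrow> sexec q G l M Y \<Longrightarrow> sexec q G i M Y"
| out: "i < length G \<Longrightarrow> G ! i = Output a \<Longrightarrow> sfetch M a = Some Y \<Longrightarrow> sexec q G i M Y"

lemma exec_imp_sexec:
  assumes "exec q G x \<delta> i m y" "\<And>k. m k = map_option (\<lambda>f. f (($) x) \<delta>) (M k)"
  shows "\<exists>Y. sexec q G i M Y \<and> Y (($) x) \<delta> = y"
  using assms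
proof (induction arbitrary: M rule: exec.induct)
  case (compute i j as k m vs y)
  have fetch: "fetch x m a = map_option (\<lambda>f. f (($) x) \<delta>) (sfetch M a)" for a
    using compute.prems by (cases a) auto
  define fs where "fs = map (\<lambda>a. the (sfetch M a)) as"
  have len: "length vs = length as" using compute.hyps(3) by (metis length_map)
  have some: "fetch x m (as ! r) = Some (vs ! r)" if "r < length as" for r
    using arg_cong[OF compute.hyps(3), of "\<lambda>l. l ! r"] that len by simp
  have sf: "map (sfetch M) as = map Some fs"
    unfolding fs_def
  proof (intro nth_equalityI)
    fix r assume "r < length (map (sfetch M) as)"
    then show "map (sfetch M) as ! r = map Some (map (\<lambda>a. the (sfetch M a)) as) ! r"
      using some[of r] fetch[of "as ! r"] by auto
  qed simp
  have vs: "vs = map (\<lambda>f. f (($) x) \<delta>) fs"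
  proof (intro nth_equalityI)
    fix r assume "r < length vs"
    then show "vs ! r = map (\<lambda>f. f (($) x) \<delta>) fs ! r"
      using some[of r] fetch[of "as ! r"] len by (auto simp: fs_def)
  qed (simp add: len fs_def)
  let ?M = "M(i \<mapsto> (\<lambda>x \<delta>. peval (\<lambda>r. map (\<lambda>f. f x \<delta>) fs ! r) (q j) * (1 + \<delta> i)))"
  have "(m(i \<mapsto> peval (\<lambda>r. vs ! r) (q j) * (1 + \<delta> i))) l =
      map_option (\<lambda>f. f (($) x) \<delta>) (?M l)" for l
    using compute.prems[of l] by (auto simp: vs)
  from compute.IH[OF this] obtain Y where "sexec q G k ?M Y" "Y (($) x) \<delta> = y" by blast
  with compute.hyps(1,2) sf show ?case by (blast intro: sexec.compute)
next
  case (negate i a k m v y)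
  have "fetch x m a = map_option (\<lambda>f. f (($) x) \<delta>) (sfetch M a)"
    using negate.prems by (cases a) auto
  with negate.hyps(3) obtain f where f: "sfetch M a = Some f" "v = f (($) x) \<delta>" by auto
  have "(m(i \<mapsto> - v)) l = map_option (\<lambda>f. f (($) x) \<delta>) ((M(i \<mapsto> (\<lambda>x \<delta>. - f x \<delta>))) l)" for l
    using negate.prems[of l] by (auto simp: f)
  from negate.IH[OF this] obtain Y
    where "sexec q G k (M(i \<mapsto> (\<lambda>x \<delta>. - f x \<delta>))) Y" "Y (($) x) \<delta> = y" by blast
  with negate.hyps(1,2) f(1) show ?case by (blast intro: sexec.negate)
next
  case (branch i R a b k l m v w y)
  from branch.IH[OF branch.prems] obtain Y
    where "sexec q G (if R v w then k else l) M Y" "Y (($) x) \<delta> = y" by blast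
  with branch.hyps(1,2) show ?case
    by (cases "R v w") (auto intro: sexec.branch_yes sexec.branch_no)
next
  case (out i a m y)
  have "fetch x m a = map_option (\<lambda>f. f (($) x) \<delta>) (sfetch M a)"
    using out.prems by (cases a) auto
  with out.hyps show ?case by (auto intro: sexec.out)
qed

lemma finite_sexec:
  assumes wf: "\<And>i. i < length G \<Longrightarrow> wf_node J ar C (length G) i (G ! i)"
  shows "finite {Y. sexec q G i M Y}"
proof (induction "length G - i" arbitrary: i M rule: less_induct)
  case less
  show ?case
  proof (cases "i < length G")
    case False
    then have "{Y. sexec q G i M Y} = {}" by (auto elim: sexec.cases)
    then show ?thesis by (simp only: finite.emptyI)
  next
    case True
    have IH: "finite {Y. sexec q G k M' Y}" if "i < k" for k M'
      using that True by (intro less) auto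
    show ?thesis
    proof (cases "G ! i")
      case (Compute j as k)
      then have k: "i < k" using wf[OF True] by simp
      show ?thesis
      proof (cases "\<exists>vs. map (sfetch M) as = map Some vs")
        case False
        then have "{Y. sexec q G i M Y} = {}" using Compute by (auto elim: sexec.cases)
        then show ?thesis by (simp only: finite.emptyI)
      next
        case ex: True
        then obtain vs where vs: "map (sfetch M) as = map Some vs" by blast
        have uniq: "us = vs" if "map (sfetch M) as = map Some us" for us
          using that vs inj_map_eq_map[OF inj_Some, of us vs] by simp
        have "{Y. sexec q G i M Y} \<subseteq> {Y. sexec q G k
            (M(i \<mapsto> (\<lambda>x \<delta>. peval (\<lambda>r. map (\<lambda>f. f x \<delta>) vs ! r) (q j) * (1 + \<delta> i)))) Y}"
        proof
          fix Y assume "Y \<in> {Y. sexec q G i M Y}"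
          then have "sexec q G i M Y" by simp
          then obtain us where "map (sfetch M) as = map Some us" and "sexec q G k
              (M(i \<mapsto> (\<lambda>x \<delta>. peval (\<lambda>r. map (\<lambda>f. f x \<delta>) us ! r) (q j) * (1 + \<delta> i)))) Y"
            using Compute by cases auto
          then show "Y \<in> {Y. sexec q G k
              (M(i \<mapsto> (\<lambda>x \<delta>. peval (\<lambda>r. map (\<lambda>f. f x \<delta>) vs ! r) (q j) * (1 + \<delta> i)))) Y}"
            unfolding uniq[OF \<open>map (sfetch M) as = map Some us\<close>] by simp
        qed
        then show ?thesis using IH[OF k] by (rule finite_subset)
      qed
    next
      case (Negate a k)
      then have k: "i < k" using wf[OF True] by simp
      have "{Y. sexec q G i M Y} \<subseteq>
          {Y. sexec q G k (M(i \<mapsto> (\<lambda>x \<delta>. - the (sfetch M a) x \<delta>))) Y}"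
      proof
        fix Y assume "Y \<in> {Y. sexec q G i M Y}"
        then have "sexec q G i M Y" by simp
        then show "Y \<in> {Y. sexec q G k (M(i \<mapsto> (\<lambda>x \<delta>. - the (sfetch M a) x \<delta>))) Y}"
          using Negate by cases auto
      qed
      then show ?thesis using IH[OF k] by (rule finite_subset)
    next
      case (Branch R a b k l)
      then have k: "i < k" "i < l" using wf[OF True] by auto
      have "{Y. sexec q G i M Y} \<subseteq> {Y. sexec q G k M Y} \<union> {Y. sexec q G l M Y}"
      proof
        fix Y assume "Y \<in> {Y. sexec q G i M Y}"
        then have "sexec q G i M Y" by simp
        then show "Y \<in> {Y. sexec q G k M Y} \<union> {Y. sexec q G l M Y}"
          using Branch by cases auto
      qed
      then show ?thesis using IH[OF k(1)] IH[OF k(2)] by (rule finite_subset[OF _ finite_UnI])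
    next
      case (Output a)
      have "{Y. sexec q G i M Y} \<subseteq> {the (sfetch M a)}"
      proof
        fix Y assume "Y \<in> {Y. sexec q G i M Y}"
        then have "sexec q G i M Y" by simp
        then show "Y \<in> {the (sfetch M a)}"
          using Output by cases auto
      qed
      then show ?thesis by (rule finite_subset) simp
    qed
  qed
qed

text \<open>The property that is propagated through an algorithm at a point \<open>w\<close> outside the zeros of the
  nonconstant forms: a value vanishes at \<open>w\<close> for all rounding errors only if it vanishes everywhere.\<close>

definition faithful :: "('n \<Rightarrow> complex) \<Rightarrow> 'n sval \<Rightarrow> bool" where
  "faithful w f \<longleftrightarrow> (\<forall>x \<delta>. f x \<delta> = 0) \<or> (\<exists>\<delta>. f w \<delta> \<noteq> 0)"

text \<open>The values that can be the operands of node \<open>i\<close>; they do not depend on its rounding error and on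
  later ones.\<close>

definition tame :: "('n \<Rightarrow> complex) \<Rightarrow> nat \<Rightarrow> 'n sval \<Rightarrow> bool" where
  "tame w i f \<longleftrightarrow> faithful w f \<and> (\<forall>x. polyfun (f x)) \<and> (\<forall>\<delta>. polyfun (\<lambda>x. f x \<delta>)) \<and>
     (\<forall>x \<delta> \<delta>'. (\<forall>v<i. \<delta> v = \<delta>' v) \<longrightarrow> f x \<delta> = f x \<delta>')"

lemma tame_mono: "tame w i f \<Longrightarrow> i \<le> k \<Longrightarrow> tame w k f"
  unfolding tame_def by (meson order_less_le_trans)

lemma tame_zero: "tame w i (\<lambda>x \<delta>. 0)"
  by (simp add: tame_def faithful_def)

lemma tame_scale:
  assumes "tame w i f" "s \<noteq> 0"
  shows "tame w i (\<lambda>x \<delta>. s * f x \<delta>)"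
  unfolding tame_def
proof (intro conjI allI impI)
  show "faithful w (\<lambda>x \<delta>. s * f x \<delta>)"
    using assms by (auto simp: tame_def faithful_def)
  show "s * f x \<delta> = s * f x \<delta>'" if "\<forall>v<i. \<delta> v = \<delta>' v" for x \<delta> \<delta>'
    using assms(1) that unfolding tame_def by metis
qed (use assms in \<open>auto simp: tame_def\<close>)

lemma tame_rounded:
  assumes "tame w i f"
  shows "tame w (Suc i) (\<lambda>x \<delta>. f x \<delta> * (1 + \<delta> i))"
  unfolding tame_def
proof (intro conjI allI impI)
  have dep: "f x \<delta> = f x \<delta>'" if "\<forall>v<i. \<delta> v = \<delta>' v" for x \<delta> \<delta>'
    using assms that unfolding tame_def by blast
  show "faithful w (\<lambda>x \<delta>. f x \<delta> * (1 + \<delta> i))"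
  proof (cases "\<exists>\<delta>. f w \<delta> \<noteq> 0")
    case True
    then obtain \<delta> where "f w \<delta> \<noteq> 0" by blast
    moreover have "f w (\<delta>(i := 0)) = f w \<delta>" by (rule dep) simp
    ultimately have "f w (\<delta>(i := 0)) * (1 + (\<delta>(i := 0)) i) \<noteq> 0" by simp
    then show ?thesis unfolding faithful_def by blast
  qed (use assms in \<open>auto simp: tame_def faithful_def\<close>)
  show "f x \<delta> * (1 + \<delta> i) = f x \<delta>' * (1 + \<delta>' i)" if "\<forall>v<Suc i. \<delta> v = \<delta>' v" for x \<delta> \<delta>'
    using dep[of \<delta> \<delta>' x] that by simp
qed (use assms in \<open>auto simp: tame_def\<close>)

lemma tame_product:
  assumes "tame w i f" "tame w i g"
  shows "tame w i (\<lambda>x \<delta>. f x \<delta> * g x \<delta>)"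
  unfolding tame_def
proof (intro conjI allI impI)
  show "faithful w (\<lambda>x \<delta>. f x \<delta> * g x \<delta>)"
  proof (cases "(\<exists>\<delta>. f w \<delta> \<noteq> 0) \<and> (\<exists>\<delta>. g w \<delta> \<noteq> 0)")
    case True
    then obtain \<delta> \<delta>' where "f w \<delta> \<noteq> 0" "g w \<delta>' \<noteq> 0" by blast
    moreover have "polyfun (f w)" "polyfun (g w)" using assms by (auto simp: tame_def)
    ultimately have "\<exists>\<delta>. f w \<delta> * g w \<delta> \<noteq> 0"
      using polyfun_mult_eq_0[of "f w" "g w" \<delta> \<delta>'] by auto
    then show ?thesis unfolding faithful_def by blast
  next
    case False
    then show ?thesis using assms by (auto simp: tame_def faithful_def)
  qed
  show "f x \<delta> * g x \<delta> = f x \<delta>' * g x \<delta>'" if "\<forall>v<i. \<delta> v = \<delta>' v" for x \<delta> \<delta>'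
    using assms that unfolding tame_def by metis
qed (use assms in \<open>auto simp: tame_def\<close>)

text \<open>Results of distinct nodes are linearly independent as functions of the rounding errors. Indeed, the
  error \<open>-1\<close> at the last node wipes out its result and leaves the earlier ones unchanged, so that
  the relation holds without this node; then its own term is 0 as well.\<close>

lemma rounded_independent:
  fixes h :: "nat \<Rightarrow> (nat \<Rightarrow> complex) \<Rightarrow> complex"
  assumes "\<And>\<delta>. g + (\<Sum>u<i. c u * h u \<delta>) = 0"
    and "\<And>u \<delta>. u < i \<Longrightarrow> \<delta> u = -1 \<Longrightarrow> h u \<delta> = 0"
    and "\<And>u \<delta> \<delta>'. u < i \<Longrightarrow> (\<forall>v\<le>u. \<delta> v = \<delta>' v) \<Longrightarrow> h u \<delta> = h u \<delta>'"
    and "u < i"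
  shows "c u * h u \<delta> = 0"
  using assms
proof (induction i arbitrary: u \<delta>)
  case 0
  from 0(4) show ?case by simp
next
  case (Suc i)
  have sum: "g + (\<Sum>u<i. c u * h u \<delta>) = 0" for \<delta>
  proof -
    let ?d = "\<delta>(i := -1)"
    have "(\<Sum>u<i. c u * h u ?d) = (\<Sum>u<i. c u * h u \<delta>)"
    proof (intro sum.cong refl)
      fix u assume "u \<in> {..<i}"
      then have "h u ?d = h u \<delta>" by (intro Suc.prems(3)) auto
      then show "c u * h u ?d = c u * h u \<delta>" by simp
    qed
    moreover have "h i ?d = 0" by (rule Suc.prems(2)) auto
    ultimately show ?thesis
      using Suc.prems(1)[of ?d] unfolding sum.lessThan_Suc by (simp only: mult_zero_right add_0_right)
  qed
  show ?case
  proof (cases "u = i")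
    case True
    have "(g + (\<Sum>u<i. c u * h u \<delta>)) + c i * h i \<delta> = 0"
      using Suc.prems(1)[of \<delta>] by (simp add: add.assoc)
    then show ?thesis using sum[of \<delta>] True by simp
  next
    case False
    show ?thesis
    proof (rule Suc.IH[OF sum])
      show "h u \<delta> = 0" if "u < i" "\<delta> u = -1" for u \<delta>
        using that by (intro Suc.prems(2)) auto
      show "h u \<delta> = h u \<delta>'" if "u < i" "\<forall>v\<le>u. \<delta> v = \<delta>' v" for u \<delta> \<delta>'
        using that by (intro Suc.prems(3)) auto
      show "u < i" using False Suc.prems(4) by simp
    qed
  qed
qed

fun dval :: "(nat \<Rightarrow> 'n sval) \<Rightarrow> 'n datum \<Rightarrow> 'n sval" where
  "dval H (Input m) = (\<lambda>x \<delta>. x m)"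
| "dval H (Result u) = H u"

text \<open>The computed results \<open>H\<close> are kept apart from the negations applied to them: \<open>represented\<close> says that a
  value is an input or a computed result up to sign. Only in this form can the occurrences of one
  node among the operands of a black box be collected. Nodes that apply no black box, and nodes that
  are skipped, count as nodes with result 0.\<close>

definition history :: "('n \<Rightarrow> complex) \<Rightarrow> nat \<Rightarrow> (nat \<Rightarrow> 'n sval) \<Rightarrow> bool" where
  "history w i H \<longleftrightarrow> (\<forall>u<i. \<exists>f. tame w u f \<and> H u = (\<lambda>x \<delta>. f x \<delta> * (1 + \<delta> u)))"

definition represented :: "nat \<Rightarrow> (nat \<Rightarrow> 'n sval) \<Rightarrow> 'n sval \<Rightarrow> bool" where
  "represented i H f \<longleftrightarrow> (\<exists>s d. s \<in> {1, -1} \<and> (\<forall>u. d = Result u \<longrightarrow> u < i) \<and>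
     f = (\<lambda>x \<delta>. s * dval H d x \<delta>))"

lemma history_tame:
  assumes "history w i H" "u < i"
  shows "tame w i (H u)" "\<delta> u = -1 \<Longrightarrow> H u x \<delta> = 0"
    "(\<forall>v\<le>u. \<delta> v = \<delta>' v) \<Longrightarrow> H u x \<delta> = H u x \<delta>'"
proof -
  obtain f where f: "tame w u f" "H u = (\<lambda>x \<delta>. f x \<delta> * (1 + \<delta> u))"
    using assms unfolding history_def by blast
  then have t: "tame w (Suc u) (H u)" using tame_rounded by simp
  then show "tame w i (H u)" using assms(2) by (auto intro: tame_mono)
  show "H u x \<delta> = 0" if "\<delta> u = -1" using f(2) that by simp
  show "H u x \<delta> = H u x \<delta>'" if "\<forall>v\<le>u. \<delta> v = \<delta>' v"
    using t that unfolding tame_def less_Suc_eq_le by blast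
qed

lemma represented_tame:
  assumes "history w i H" "\<And>m. w m \<noteq> 0" "represented i H f"
  shows "tame w i f"
proof -
  obtain s d where d: "s \<in> {1, -1}" "\<forall>u. d = Result u \<longrightarrow> u < i" "f = (\<lambda>x \<delta>. s * dval H d x \<delta>)"
    using assms(3) unfolding represented_def by blast
  have "tame w i (dval H d)"
  proof (cases d)
    case (Input m)
    then show ?thesis using assms(2) by (auto simp: tame_def faithful_def)
  next
    case (Result u)
    then show ?thesis using history_tame(1)[OF assms(1)] d(2) by simp
  qed
  then show ?thesis unfolding d(3) using d(1) by (intro tame_scale) auto
qed

text \<open>The operands that are computed results contribute a linear combination of these results. If the value
  is zero at \<open>w\<close> for all rounding errors, then independence forces each term of the combination to
  vanish at \<open>w\<close>, hence everywhere. What remains is the black box applied to the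
  inputs among its operands and to 0 in place of the others: a form that vanishes at \<open>w\<close>.\<close>

lemma affine_value_tame:
  fixes w :: "'n \<Rightarrow> complex"
  assumes hist: "history w i H" and w: "\<And>m. w m \<noteq> 0"
    and vs: "\<And>f. f \<in> set vs \<Longrightarrow> represented i H f"
    and aff: "affine_poly p" "vars p \<subseteq> {..<length vs}"
    and avoid: "\<And>\<sigma> s. \<forall>r. \<sigma> r \<in> {0, 1, -1} \<Longrightarrow> form p \<sigma> s w = 0 \<Longrightarrow> \<forall>x. form p \<sigma> s x = 0"
  shows "tame w i (\<lambda>x \<delta>. peval (\<lambda>r. map (\<lambda>f. f x \<delta>) vs ! r) p)"
proof -
  let ?k = "length vs"
  obtain c0 c where c: "\<And>y. peval y p = c0 + (\<Sum>r<?k. c r * y r)"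
    using affine_poly_eval[OF aff] by blast
  have "\<forall>r\<in>{..<?k}. \<exists>s d. s \<in> {1, -1} \<and> (\<forall>u. d = Result u \<longrightarrow> u < i) \<and>
     vs ! r = (\<lambda>x \<delta>. s * dval H d x \<delta>)"
    using vs unfolding represented_def by simp
  then obtain s where "\<forall>r\<in>{..<?k}. \<exists>d. s r \<in> {1, -1} \<and> (\<forall>u. d = Result u \<longrightarrow> u < i) \<and>
     vs ! r = (\<lambda>x \<delta>. s r * dval H d x \<delta>)"
    by (rule bchoice[THEN exE])
  then obtain d where "\<forall>r\<in>{..<?k}. s r \<in> {1, -1} \<and> (\<forall>u. d r = Result u \<longrightarrow> u < i) \<and>
     vs ! r = (\<lambda>x \<delta>. s r * dval H (d r) x \<delta>)"
    by (rule bchoice[THEN exE])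
  then have sd: "\<And>r. r < ?k \<Longrightarrow> s r \<in> {1, -1}"
    "\<And>r u. r < ?k \<Longrightarrow> d r = Result u \<Longrightarrow> u < i"
    "\<And>r. r < ?k \<Longrightarrow> vs ! r = (\<lambda>x \<delta>. s r * dval H (d r) x \<delta>)"
    by auto
  define val where "val x \<delta> = peval (\<lambda>r. map (\<lambda>f. f x \<delta>) vs ! r) p" for x \<delta>
  have val: "val x \<delta> = c0 + (\<Sum>r<?k. c r * (vs ! r) x \<delta>)" for x \<delta>
    by (simp add: val_def c)
  have vst: "tame w i (vs ! r)" if "r < ?k" for r
    using that by (intro represented_tame[OF hist w] vs) auto
  \<comment> \<open>The form that is left when computed operands are replaced by 0; \<open>K u\<close> collects the coefficients of the result of node \<open>u\<close>.\<close>
  define \<sigma> where "\<sigma> r = (if r < ?k then case d r of Input m \<Rightarrow> s r | Result u \<Rightarrow> 0 else 0)" for r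
  define \<tau> where "\<tau> r = (case d r of Input m \<Rightarrow> m | Result u \<Rightarrow> undefined)" for r
  define K where "K u = (\<Sum>r<?k. if d r = Result u then c r * s r else 0)" for u
  have \<sigma>: "\<forall>r. \<sigma> r \<in> {0, 1, -1}"
    using sd(1) by (auto simp: \<sigma>_def split: datum.splits)
  have split: "val x \<delta> = form p \<sigma> \<tau> x + (\<Sum>u<i. K u * H u x \<delta>)" for x \<delta>
  proof -
    have "c r * (vs ! r) x \<delta> = c r * (\<sigma> r * x (\<tau> r)) +
        (\<Sum>u<i. (if d r = Result u then c r * s r else 0) * H u x \<delta>)" if r: "r < ?k" for r
    proof (cases "d r")
      case (Input m)
      then show ?thesis using sd(3)[OF r] r by (simp add: \<sigma>_def \<tau>_def)
    next
      case (Result u)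
      have "(\<Sum>v<i. (if d r = Result v then c r * s r else 0) * H v x \<delta>) =
          (\<Sum>v<i. if v = u then c r * s r * H u x \<delta> else 0)"
        using Result by (intro sum.cong) auto
      also have "\<dots> = c r * s r * H u x \<delta>" using sd(2)[OF r Result] by simp
      finally show ?thesis using sd(3)[OF r] r Result by (simp add: \<sigma>_def)
    qed
    then have "val x \<delta> = c0 + (\<Sum>r<?k. c r * (\<sigma> r * x (\<tau> r)) +
        (\<Sum>u<i. (if d r = Result u then c r * s r else 0) * H u x \<delta>))"
      by (simp add: val)
    also have "\<dots> = form p \<sigma> \<tau> x +
        (\<Sum>r<?k. \<Sum>u<i. (if d r = Result u then c r * s r else 0) * H u x \<delta>)"
      by (simp add: sum.distrib form_def c)
    also have "(\<Sum>r<?k. \<Sum>u<i. (if d r = Result u then c r * s r else 0) * H u x \<delta>) =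
        (\<Sum>u<i. K u * H u x \<delta>)"
      unfolding K_def sum_distrib_right by (rule sum.swap)
    finally show ?thesis .
  qed
  have "faithful w val"
  proof (cases "\<exists>\<delta>. val w \<delta> \<noteq> 0")
    case False
    have zero: "K u * H u w \<delta> = 0" if "u < i" for u \<delta>
    proof (rule rounded_independent[where h = "\<lambda>u. H u w" and g = "form p \<sigma> \<tau> w"])
      show "form p \<sigma> \<tau> w + (\<Sum>u<i. K u * H u w \<delta>) = 0" for \<delta>
        using False split by simp
    qed (use history_tame(2,3)[OF hist] that in auto)
    have KH: "K u * H u x \<delta> = 0" if "u < i" for u x \<delta>
    proof (cases "K u = 0")
      case False
      then have "H u w \<delta> = 0" for \<delta> using zero[OF that, of \<delta>] by simp
      then show ?thesis using history_tame(1)[OF hist that] unfolding tame_def faithful_def by simp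
    qed simp
    have "(\<Sum>u<i. K u * H u x \<delta>) = 0" for x \<delta>
      using KH by (intro sum.neutral) blast
    then have val_form: "val x \<delta> = form p \<sigma> \<tau> x" for x \<delta> using split by simp
    then have "form p \<sigma> \<tau> w = 0" using False by auto
    then have "\<forall>x. form p \<sigma> \<tau> x = 0" by (rule avoid[OF \<sigma>])
    then show ?thesis by (simp add: faithful_def val_form)
  qed (simp add: faithful_def)
  moreover have "polyfun (val x)" for x
    unfolding val using vst by (intro polyfun.add polyfun_sum polyfun.mult) (auto simp: tame_def)
  moreover have "polyfun (\<lambda>x. val x \<delta>)" for \<delta>
    unfolding val using vst by (intro polyfun.add polyfun_sum polyfun.mult) (auto simp: tame_def)
  moreover have "val x \<delta> = val x \<delta>'" if "\<forall>v<i. \<delta> v = \<delta>' v" for x \<delta> \<delta>'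
  proof -
    have "(vs ! r) x \<delta> = (vs ! r) x \<delta>'" if "r < ?k" for r
      using vst[OF that] \<open>\<forall>v<i. \<delta> v = \<delta>' v\<close> unfolding tame_def by blast
    then show ?thesis by (simp add: val)
  qed
  ultimately have "tame w i val" unfolding tame_def by blast
  then show ?thesis by (simp add: val_def[abs_def])
qed

definition invariant :: "('n \<Rightarrow> complex) \<Rightarrow> nat \<Rightarrow> (nat \<rightharpoonup> 'n sval) \<Rightarrow> bool" where
  "invariant w i M \<longleftrightarrow> (\<exists>H. history w i H \<and> (\<forall>k f. M k = Some f \<longrightarrow> represented i H f))"

lemma invariant_step:
  assumes hist: "history w i H" and M: "\<And>k f. M k = Some f \<Longrightarrow> represented i H f"
    and f: "tame w i f" and "i < k"
  shows "invariant w k (M(i \<mapsto> (\<lambda>x \<delta>. f x \<delta> * (1 + \<delta> i))))"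
    and "represented i H g \<Longrightarrow> invariant w k (M(i \<mapsto> g))"
    and "invariant w k M"
proof -
  define H' where "H' u = (if u < i then H u else if u = i then (\<lambda>x \<delta>. f x \<delta> * (1 + \<delta> i))
    else (\<lambda>x \<delta>. 0))" for u
  have hist': "history w k H'"
    unfolding history_def
  proof (intro allI impI)
    fix u assume "u < k"
    consider "u < i" | "u = i" | "u > i" by linarith
    then show "\<exists>f. tame w u f \<and> H' u = (\<lambda>x \<delta>. f x \<delta> * (1 + \<delta> u))"
    proof cases
      case 1
      then show ?thesis using hist by (simp add: history_def H'_def)
    next
      case 2
      then show ?thesis using f by (intro exI[of _ f]) (simp add: H'_def)
    next
      case 3
      then show ?thesis using tame_zero by (intro exI[of _ "\<lambda>x \<delta>. 0"]) (simp add: H'_def)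
    qed
  qed
  have rep': "represented k H' g" if "represented i H g" for g
  proof -
    obtain s d where d: "s \<in> {1, -1}" "\<forall>u. d = Result u \<longrightarrow> u < i" "g = (\<lambda>x \<delta>. s * dval H d x \<delta>)"
      using \<open>represented i H g\<close> unfolding represented_def by blast
    have "dval H' d = dval H d" using d(2) by (cases d) (auto simp: H'_def)
    then show ?thesis unfolding represented_def using d \<open>i < k\<close>
      by (intro exI[of _ s] exI[of _ d]) auto
  qed
  have new: "represented k H' (\<lambda>x \<delta>. f x \<delta> * (1 + \<delta> i))"
    unfolding represented_def using \<open>i < k\<close>
    by (intro exI[of _ 1] exI[of _ "Result i"]) (auto simp: H'_def)
  show "invariant w k (M(i \<mapsto> (\<lambda>x \<delta>. f x \<delta> * (1 + \<delta> i))))"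
    unfolding invariant_def using hist' new rep' M by (intro exI[of _ H']) auto
  show "invariant w k (M(i \<mapsto> g))" if "represented i H g"
    unfolding invariant_def using hist' rep' that M by (intro exI[of _ H']) auto
  show "invariant w k M"
    unfolding invariant_def using hist' rep' M by (intro exI[of _ H']) auto
qed

text \<open>A product of two operands that are not identically zero at \<open>w\<close> is not identically zero there, since
  polynomials in the rounding errors have no zero divisors. The affine case is the one where the forms
  enter.\<close>

lemma sexec_tame:
  fixes w :: "'n \<Rightarrow> complex"
  assumes wf: "\<And>i. i < length G \<Longrightarrow> wf_node J ar C (length G) i (G ! i)"
    and w: "\<And>m. w m \<noteq> 0"
    and ops: "\<And>i j as k. i < length G \<Longrightarrow> G ! i = Compute j as k \<Longrightarrow>
      q j = Var 0 * Var 1 \<and> ar j = 2 \<or> affine_poly (q j) \<and> vars (q j) \<subseteq> {..<ar j} \<and>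
        (\<forall>\<sigma> s. (\<forall>r. \<sigma> r \<in> {0, 1, -1}) \<longrightarrow> form (q j) \<sigma> s w = 0 \<longrightarrow> (\<forall>x. form (q j) \<sigma> s x = 0))"
    and "sexec q G i M Y" "invariant w i M"
  shows "\<exists>n. tame w n Y"
  using assms(4,5)
proof (induction rule: sexec.induct)
  case (compute i j as k M vs Y)
  then obtain H where hist: "history w i H"
    and M: "\<And>k f. M k = Some f \<Longrightarrow> represented i H f" by (auto simp: invariant_def)
  have "i < k" and len: "length as = ar j" using wf[OF compute.hyps(1)] compute.hyps(2) by auto
  have len': "length vs = ar j" using compute.hyps(3) len by (metis length_map)
  have vs: "represented i H f" if f: "f \<in> set vs" for f
  proof -
    have "Some f \<in> set (map (sfetch M) as)" using f unfolding compute.hyps(3) by simp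
    then obtain a where "sfetch M a = Some f" by auto
    then show ?thesis
    proof (cases a)
      case (Input m)
      with \<open>sfetch M a = Some f\<close> show ?thesis unfolding represented_def
        by (intro exI[of _ 1] exI[of _ "Input m"]) auto
    qed (use M in auto)
  qed
  have "tame w i (\<lambda>x \<delta>. peval (\<lambda>r. map (\<lambda>f. f x \<delta>) vs ! r) (q j))"
    using ops[OF compute.hyps(1,2)]
  proof
    assume q: "q j = Var 0 * Var 1 \<and> ar j = 2"
    have "tame w i (\<lambda>x \<delta>. (vs ! 0) x \<delta> * (vs ! 1) x \<delta>)"
      using q len' by (intro tame_product represented_tame[OF hist w] vs) auto
    then show ?thesis using q len' by simp
  next
    assume "affine_poly (q j) \<and> vars (q j) \<subseteq> {..<ar j} \<and>
        (\<forall>\<sigma> s. (\<forall>r. \<sigma> r \<in> {0, 1, -1}) \<longrightarrow> form (q j) \<sigma> s w = 0 \<longrightarrow> (\<forall>x. form (q j) \<sigma> s x = 0))"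
    then show ?thesis using len' by (intro affine_value_tame[OF hist w vs]) auto
  qed
  from invariant_step(1)[OF hist M this \<open>i < k\<close>] show ?case by (rule compute.IH)
next
  case (negate i a k M f Y)
  then obtain H where hist: "history w i H"
    and M: "\<And>k f. M k = Some f \<Longrightarrow> represented i H f" by (auto simp: invariant_def)
  have "i < k" using wf[OF negate.hyps(1)] negate.hyps(2) by auto
  have "represented i H f"
  proof (cases a)
    case (Input m)
    with negate.hyps(3) show ?thesis unfolding represented_def
      by (intro exI[of _ 1] exI[of _ "Input m"]) auto
  qed (use M negate.hyps(3) in auto)
  then obtain s d where d: "s \<in> {1, -1}" "\<forall>u. d = Result u \<longrightarrow> u < i" "f = (\<lambda>x \<delta>. s * dval H d x \<delta>)"
    unfolding represented_def by blast
  have "represented i H (\<lambda>x \<delta>. - f x \<delta>)"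
    unfolding represented_def using d by (intro exI[of _ "- s"] exI[of _ d]) auto
  from invariant_step(2)[OF hist M tame_zero \<open>i < k\<close> this] show ?case by (rule negate.IH)
next
  case (branch_yes i R a b k l M Y)
  then obtain H where "history w i H" "\<And>k f. M k = Some f \<Longrightarrow> represented i H f"
    by (auto simp: invariant_def)
  moreover have "i < k" using wf[OF branch_yes.hyps(1)] branch_yes.hyps(2) by auto
  ultimately have "invariant w k M" using invariant_step(3)[OF _ _ tame_zero] by blast
  then show ?case by (rule branch_yes.IH)
next
  case (branch_no i R a b k l M Y)
  then obtain H where "history w i H" "\<And>k f. M k = Some f \<Longrightarrow> represented i H f"
    by (auto simp: invariant_def)
  moreover have "i < l" using wf[OF branch_no.hyps(1)] branch_no.hyps(2) by auto
  ultimately have "invariant w l M" using invariant_step(3)[OF _ _ tame_zero] by blast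
  then show ?case by (rule branch_no.IH)
next
  case (out i a M Y)
  then obtain H where hist: "history w i H"
    and M: "\<And>k f. M k = Some f \<Longrightarrow> represented i H f" by (auto simp: invariant_def)
  have "represented i H Y"
  proof (cases a)
    case (Input m)
    with out.hyps(3) show ?thesis unfolding represented_def
      by (intro exI[of _ 1] exI[of _ "Input m"]) auto
  qed (use M out.hyps(3) in auto)
  from represented_tame[OF hist w this] show ?case by blast
qed

lemma eventually_poly_nonzero:
  fixes P :: "complex poly"
  assumes "P \<noteq> 0"
  shows "eventually (\<lambda>t. poly P t \<noteq> 0) (at 0)"
  unfolding eventually_at_topological
proof (intro exI conjI ballI impI)
  show "open (- ({t. poly P t = 0} - {0}))"
    using poly_roots_finite[OF assms] by (intro open_Compl finite_imp_closed) auto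
qed auto

text \<open>A common point with nonzero values is scaled down towards 0; on the line through 0 only finitely many
  scalings have to be avoided.\<close>

lemma small_common_nonzero:
  fixes f :: "'i \<Rightarrow> (nat \<Rightarrow> complex) \<Rightarrow> complex" and \<epsilon> :: real
  assumes "finite I" "\<And>k. k \<in> I \<Longrightarrow> polyfun (f k)" "\<And>k. k \<in> I \<Longrightarrow> \<exists>\<delta>. f k \<delta> \<noteq> 0" "0 < \<epsilon>"
  shows "\<exists>\<delta>. (\<forall>i<n. norm (\<delta> i) \<le> \<epsilon>) \<and> (\<forall>k\<in>I. f k \<delta> \<noteq> 0)"
proof -
  have "\<exists>a. \<forall>k\<in>I. f k a \<noteq> 0"
    using assms(1-3) by (rule common_nonzero_UNIV)
  then obtain a where a: "\<forall>k\<in>I. f k a \<noteq> 0" by blast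
  have "eventually (\<lambda>t. f k (\<lambda>i. t * a i) \<noteq> 0) (at 0)" if k: "k \<in> I" for k
  proof -
    obtain P where P: "\<And>t. f k (\<lambda>i. 0 + t * a i) = poly P t"
      using polyfun_on_line[OF assms(2)[OF k], of "\<lambda>_. 0" a] by blast
    have "P \<noteq> 0" using P[of 1] a k by auto
    from eventually_poly_nonzero[OF this] show ?thesis by (simp add: P[symmetric])
  qed
  then have 1: "eventually (\<lambda>t. \<forall>k\<in>I. f k (\<lambda>i. t * a i) \<noteq> 0) (at 0)"
    using assms(1) by (intro eventually_ball_finite) auto
  have "eventually (\<lambda>t. norm (t * a i) < \<epsilon>) (at 0)" for i
  proof -
    have "((\<lambda>t. norm (t * a i)) \<longlongrightarrow> norm (0 * a i)) (at 0)"
      by (intro tendsto_intros)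
    then show ?thesis using \<open>0 < \<epsilon>\<close> by (intro order_tendstoD) auto
  qed
  then have 2: "eventually (\<lambda>t. \<forall>i\<in>{..<n}. norm (t * a i) < \<epsilon>) (at 0)"
    by (intro eventually_ball_finite) auto
  obtain t where "\<forall>k\<in>I. f k (\<lambda>i. t * a i) \<noteq> 0" "\<forall>i\<in>{..<n}. norm (t * a i) < \<epsilon>"
    using eventually_happens'[OF at_neq_bot eventually_conj[OF 1 2]] by blast
  then show ?thesis by (intro exI[of _ "\<lambda>i. t * a i"]) (auto simp: less_imp_le)
qed

lemma p_comp_exec:
  assumes "exec q G x \<delta> 0 Map.empty y"
  shows "p_comp q G x \<delta> = y"
  unfolding p_comp_def using assms exec_deterministic by blast

text \<open>Suppose that \<open>p\<close> vanishes at \<open>w\<close>, although no coordinate does and no form does that is not zero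
  everywhere. Fix admissible rounding errors for which no path
  gives the output 0 at \<open>w\<close>, apart from paths whose output is 0 everywhere, and let the input tend
  to \<open>w\<close> on a line on which \<open>p\<close> is not identically zero. By accuracy the computed value is nonzero and of
  the size of \<open>p\<close>, so it tends to 0, whereas the outputs of the finitely many paths in question
  stay away from 0.\<close>

lemma accurate_zero_on_forms:
  fixes p :: "'n::finite cpoly" and G :: "('j, 'n) algorithm"
  assumes alg: "is_algorithm J ar q C G" and acc: "accurate_on q G p UNIV"
    and w: "\<And>m. w m \<noteq> 0"
    and ops: "\<And>i j as k. i < length G \<Longrightarrow> G ! i = Compute j as k \<Longrightarrow>
      q j = Var 0 * Var 1 \<and> ar j = 2 \<or> affine_poly (q j) \<and> vars (q j) \<subseteq> {..<ar j} \<and>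
        (\<forall>\<sigma> s. (\<forall>r. \<sigma> r \<in> {0, 1, -1}) \<longrightarrow> form (q j) \<sigma> s w = 0 \<longrightarrow> (\<forall>x. form (q j) \<sigma> s x = 0))"
    and a: "peval a p \<noteq> 0"
  shows "peval w p \<noteq> 0"
proof
  assume pw: "peval w p = 0"
  have wf: "\<And>i. i < length G \<Longrightarrow> wf_node J ar C (length G) i (G ! i)"
    and ex: "\<And>x \<delta>. \<exists>y. exec q G x \<delta> 0 Map.empty y"
    using alg by (auto simp: is_algorithm_def)
  obtain \<epsilon> :: real where \<epsilon>: "0 < \<epsilon>" and acc': "\<And>x \<delta>. (\<forall>i<length G. norm (\<delta> i) \<le> \<epsilon>) \<Longrightarrow>
      norm (p_comp q G x \<delta> - peval (($) x) p) \<le> 1 / 2 * norm (peval (($) x) p)"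
    using acc[unfolded accurate_on_def, rule_format, of "1 / 2"] by auto
  define S where "S = {Y. sexec q G 0 Map.empty Y \<and> (\<exists>\<delta>. Y w \<delta> \<noteq> 0)}"
  have fin: "finite S" using finite_sexec[OF wf, where M = Map.empty and i = 0] unfolding S_def
    by (rule rev_finite_subset) auto
  have inv: "invariant w 0 Map.empty"
    by (auto simp: invariant_def history_def)
  have tame: "\<exists>n. tame w n Y" if "sexec q G 0 Map.empty Y" for Y
    using wf w ops that inv by (rule sexec_tame)
  \<comment> \<open>One choice of rounding errors serves all paths whose output is not identically zero at \<open>w\<close>.\<close>
  have "\<exists>\<delta>. (\<forall>i<length G. norm (\<delta> i) \<le> \<epsilon>) \<and> (\<forall>Y\<in>S. Y w \<delta> \<noteq> 0)"
    using fin tame \<epsilon> by (intro small_common_nonzero) (auto simp: S_def tame_def)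
  then obtain \<delta> where \<delta>: "\<forall>i<length G. norm (\<delta> i) \<le> \<epsilon>" "\<forall>Y\<in>S. Y w \<delta> \<noteq> 0" by blast
  let ?x = "\<lambda>t i. w i + t * (a i - w i)"
  have "polyfun (\<lambda>x. peval x p)" by (rule polyfun_peval) simp
  then obtain R where R: "\<And>t. peval (?x t) p = poly R t"
    using polyfun_on_line[where a = w and b = "\<lambda>i. a i - w i"] by blast
  have "R \<noteq> 0" using R[of 1] a by auto
  have R_0: "poly R 0 = 0" using R[of 0] pw by simp
  have "eventually (\<lambda>t. 2 * norm (peval (?x t) p) < norm (Y (?x t) \<delta>)) (at 0)" if Y: "Y \<in> S" for Y
  proof -
    have "polyfun (\<lambda>x. Y x \<delta>)" using tame Y by (auto simp: S_def tame_def)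
    then obtain Q where Q: "\<And>t. Y (?x t) \<delta> = poly Q t"
      using polyfun_on_line[where a = w and b = "\<lambda>i. a i - w i"] by blast
    have "((\<lambda>t. norm (poly Q t) - 2 * norm (poly R t)) \<longlongrightarrow>
        norm (poly Q 0) - 2 * norm (poly R 0)) (at 0)"
      by (intro tendsto_intros)
    moreover have "poly Q 0 \<noteq> 0" using Q[of 0] \<delta>(2) Y by auto
    ultimately have "eventually (\<lambda>t. 0 < norm (poly Q t) - 2 * norm (poly R t)) (at 0)"
      using R_0 by (intro order_tendstoD) auto
    then show ?thesis by (simp add: Q R)
  qed
  then have 1: "eventually (\<lambda>t. \<forall>Y\<in>S. 2 * norm (peval (?x t) p) < norm (Y (?x t) \<delta>)) (at 0)"
    using fin by (intro eventually_ball_finite) auto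
  have 2: "eventually (\<lambda>t. peval (?x t) p \<noteq> 0) (at 0)"
    using eventually_poly_nonzero[OF \<open>R \<noteq> 0\<close>] by (simp add: R)
  obtain t where t: "\<forall>Y\<in>S. 2 * norm (peval (?x t) p) < norm (Y (?x t) \<delta>)" "peval (?x t) p \<noteq> 0"
    using eventually_happens'[OF at_neq_bot eventually_conj[OF 1 2]] by blast
  define v :: "complex ^ 'n" where "v = (\<chi> i. ?x t i)"
  have v: "($) v = ?x t" by (auto simp: v_def)
  obtain y where y: "exec q G v \<delta> 0 Map.empty y" using ex by blast
  obtain Y where Y: "sexec q G 0 Map.empty Y" "Y (?x t) \<delta> = y"
    using exec_imp_sexec[OF y, of Map.empty] by (auto simp: v)
  have close: "norm (y - peval (?x t) p) \<le> 1 / 2 * norm (peval (?x t) p)"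
    using acc'[OF \<delta>(1), of v] p_comp_exec[OF y] by (simp add: v)
  have "y \<noteq> 0" using close t(2) by auto
  have "\<exists>\<delta>. Y w \<delta> \<noteq> 0"
    using tame[OF Y(1)] Y(2) \<open>y \<noteq> 0\<close> unfolding tame_def faithful_def by auto
  with Y(1) have "Y \<in> S" by (simp add: S_def)
  then have "2 * norm (peval (?x t) p) < norm y" using t(1) Y(2) by blast
  moreover have "norm y \<le> norm (y - peval (?x t) p) + norm (peval (?x t) p)"
    by (metis diff_add_cancel norm_triangle_ineq)
  moreover have "norm (peval (?x t) p) > 0" using t(2) by simp
  ultimately show False using close by linarith
qed

lemma coordinate_form:
  "form (Var 0 - Var 1) (\<lambda>r. if r = 0 then 1 else 0) (\<lambda>_. m) = (\<lambda>x. x m)"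
  by (auto simp: form_def)

lemma coordinate_in_forms:
  assumes "j \<in> K" "q j = Var 0 - Var 1"
  shows "(\<lambda>x. x m) \<in> forms K q"
  unfolding forms_def mem_Collect_eq using assms coordinate_form[of m]
  by (intro exI[of _ j] exI[of _ "\<lambda>r. if r = 0 then 1 else 0"] exI[of _ "\<lambda>_. m"]) auto

lemma nonconst_affine_coordinate: "nonconst_affine (\<lambda>x. x m)"
  unfolding nonconst_affine_def by (auto intro: exI[of _ "\<lambda>_. 1"])

lemma sub_neq_mul: "Var 0 - Var 1 \<noteq> (Var 0 * Var 1 :: nat cpoly)"
proof
  assume "Var 0 - Var 1 = (Var 0 * Var 1 :: nat cpoly)"
  from arg_cong[OF this, of "peval (\<lambda>_. 1)"] show False by simp
qed

text \<open>The forms are taken from the black boxes that occur in the algorithm, so there are finitely many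
  of them, and their zeros cover those of \<open>p\<close>. Subtraction is always included since it
  provides the coordinate functions.\<close>

lemma evaluable_imp_union:
  fixes q :: "'j \<Rightarrow> nat cpoly" and p :: "'n::finite cpoly"
  assumes family: "black_box_family J ar q j_mul j_add j_sub"
    and affine: "\<forall>j\<in>J - {j_mul}. affine_poly (q j)"
    and eval: "accurately_evaluable_on J ar q C p UNIV"
  shows "\<exists>F. F \<subseteq> (\<Union>j\<in>J. black_box_varieties (ar j) (q j)) \<and> zero_set p = \<Union>F"
proof (cases "\<forall>x. peval x p = 0")
  case True
  have "j_sub \<in> J" and vars: "\<forall>j\<in>J. vars (q j) \<subseteq> {..<ar j}"
    using family unfolding black_box_family_def by blast+
  then have "{x :: complex ^ 'n. form (q j_sub) (\<lambda>_. 0) s (($) x) = 0}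
      \<in> black_box_varieties (ar j_sub) (q j_sub)" for s
    by (intro form_zeros_variety) auto
  moreover have "form (q j_sub) (\<lambda>_. 0) s x = 0" for s and x :: "'n \<Rightarrow> complex"
    using family by (simp add: black_box_family_def form_def)
  ultimately have "(UNIV :: (complex ^ 'n) set) \<in> black_box_varieties (ar j_sub) (q j_sub)" by simp
  moreover have "zero_set p = UNIV" using True by (simp add: zero_set_def)
  ultimately show ?thesis using \<open>j_sub \<in> J\<close> by (intro exI[of _ "{UNIV}"]) auto
next
  case False
  then obtain a where a: "peval a p \<noteq> 0" by blast
  obtain G where alg: "is_algorithm J ar q C G" and acc: "accurate_on q G p UNIV"
    using eval unfolding accurately_evaluable_on_def by blast
  have wf: "\<And>i. i < length G \<Longrightarrow> wf_node J ar C (length G) i (G ! i)"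
    using alg by (auto simp: is_algorithm_def)
  define K where "K = insert j_sub {j. \<exists>as k. Compute j as k \<in> set G} - {j_mul}"
  have sub: "j_sub \<in> K" "q j_sub = Var 0 - Var 1" and mul: "q j_mul = Var 0 * Var 1" "ar j_mul = 2"
    using family sub_neq_mul by (auto simp: black_box_family_def K_def)
  have J: "j \<in> J" if "Compute j as k \<in> set G" for j as k
    using that wf by (fastforce simp: in_set_conv_nth)
  have KJ: "K \<subseteq> J - {j_mul}"
    using family J by (auto simp: K_def black_box_family_def)
  then have vars: "vars (q j) \<subseteq> {..<ar j}" and aff: "affine_poly (q j)" if "j \<in> K" for j
    using that family affine by (auto simp: black_box_family_def)
  have "finite {j. \<exists>as k. Compute j as k \<in> set G}"
  proof (rule finite_subset)
    show "{j. \<exists>as k. Compute j as k \<in> set G} \<subseteq>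
        (\<lambda>n. case n of Compute j as k \<Rightarrow> j | _ \<Rightarrow> j_sub) ` set G"
      by (force simp: image_iff)
  qed simp
  then have "finite K" by (simp add: K_def)
  define L :: "(('n \<Rightarrow> complex) \<Rightarrow> complex) set" where "L = {l \<in> forms K q. nonconst_affine l}"
  have "finite (forms K q :: (('n \<Rightarrow> complex) \<Rightarrow> complex) set)"
    using \<open>finite K\<close> vars by (rule finite_forms)
  then have "finite L" by (simp add: L_def)
  have const: "\<forall>x. form (q j) \<sigma> s x = 0"
    if "j \<in> K" "\<forall>r. \<sigma> r \<in> {0, 1, -1}" "form (q j) \<sigma> s w = 0" "\<forall>l\<in>L. l w \<noteq> 0"
    for j \<sigma> s and w :: "'n \<Rightarrow> complex"
  proof -
    have "form (q j) \<sigma> s \<in> forms K q" using that(1,2) unfolding forms_def by blast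
    with that(3,4) have "\<not> nonconst_affine (form (q j) \<sigma> s)" by (auto simp: L_def)
    then have "\<forall>x. form (q j) \<sigma> s x = form (q j) \<sigma> s (\<lambda>_. 0)"
      using form_cases[OF aff[OF that(1)] vars[OF that(1)]] by blast
    then show ?thesis using that(3) by metis
  qed
  have cover: "\<exists>l\<in>L. l w = 0" if "peval w p = 0" for w
  proof (rule ccontr)
    assume "\<not> ?thesis"
    then have no: "\<forall>l\<in>L. l w \<noteq> 0" by simp
    have w: "w m \<noteq> 0" for m
    proof -
      have "(\<lambda>x. x m) \<in> forms K q" using sub by (rule coordinate_in_forms)
      then have "(\<lambda>x. x m) \<in> L" by (simp add: L_def nonconst_affine_coordinate)
      from bspec[OF no this] show ?thesis .
    qed
    have "peval w p \<noteq> 0"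
    proof (rule accurate_zero_on_forms[OF alg acc w _ a])
      fix i j as k assume i: "i < length G" "G ! i = Compute j as k"
      then have "Compute j as k \<in> set G" by (metis nth_mem)
      then have "j = j_mul \<or> j \<in> K" by (auto simp: K_def)
      then show "q j = Var 0 * Var 1 \<and> ar j = 2 \<or> affine_poly (q j) \<and> vars (q j) \<subseteq> {..<ar j} \<and>
        (\<forall>\<sigma> s. (\<forall>r. \<sigma> r \<in> {0, 1, -1}) \<longrightarrow> form (q j) \<sigma> s w = 0 \<longrightarrow> (\<forall>x. form (q j) \<sigma> s x = 0))"
      proof
        assume "j \<in> K"
        then show ?thesis using aff vars const no by blast
      qed (use mul in simp)
    qed
    with that show False by simp
  qed
  have "\<exists>ls c. set ls \<subseteq> L \<and> c \<noteq> 0 \<and> (\<forall>x. peval x p = (\<Prod>l\<leftarrow>ls. l x) * c)"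
  proof (rule product_of_affine_finite[of "\<lambda>x. peval x p", OF _ a _ \<open>finite L\<close> cover])
    show "polyfun (\<lambda>x. peval x p)" by (rule polyfun_peval) simp
  qed (auto simp: L_def)
  then obtain ls c where ls: "set ls \<subseteq> L" "c \<noteq> 0" "\<forall>x. peval x p = (\<Prod>l\<leftarrow>ls. l x) * c"
    by (elim exE conjE)
  let ?F = "(\<lambda>l. {x :: complex ^ 'n. l (($) x) = 0}) ` set ls"
  have "?F \<subseteq> (\<Union>j\<in>J. black_box_varieties (ar j) (q j))"
  proof
    fix S assume "S \<in> ?F"
    then obtain l where l: "l \<in> set ls" "S = {x. l (($) x) = 0}" by blast
    with ls(1) have "l \<in> forms K q" by (auto simp: L_def)
    then obtain j \<sigma> s where j: "j \<in> K" "\<forall>r. \<sigma> r \<in> {0, 1, -1}" "l = form (q j) \<sigma> s"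
      unfolding forms_def by blast
    then have "S \<in> black_box_varieties (ar j) (q j)"
      unfolding l(2) j(3) by (intro form_zeros_variety vars)
    then show "S \<in> (\<Union>j\<in>J. black_box_varieties (ar j) (q j))" using j(1) KJ by blast
  qed
  moreover have "zero_set p = \<Union>?F"
    using ls(2,3) by (auto simp: zero_set_def prod_list_zero_iff)
  ultimately show ?thesis by blast
qed


section \<open>Straight-line programs\<close>

text \<open>Programs without branching are written with the last node first, so that extending a program
  keeps the numbers of its nodes.\<close>

fun state :: "('j \<Rightarrow> nat cpoly) \<Rightarrow> complex ^ 'n \<Rightarrow> (nat \<Rightarrow> complex) \<Rightarrow> ('j, 'n::finite) node list
    \<Rightarrow> nat \<rightharpoonup> complex" where
  "state q x \<delta> [] = Map.empty"
| "state q x \<delta> (nd # rs) = (let M = state q x \<delta> rs; i = length rs in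
    case nd of
      Compute j as k \<Rightarrow> M(i \<mapsto> peval (\<lambda>r. map (\<lambda>a. the (fetch x M a)) as ! r) (q j) * (1 + \<delta> i))
    | Negate a k \<Rightarrow> M(i \<mapsto> - the (fetch x M a))
    | _ \<Rightarrow> M)"

fun avail :: "nat \<Rightarrow> 'n datum \<Rightarrow> bool" where
  "avail n (Input i) \<longleftrightarrow> True"
| "avail n (Result k) \<longleftrightarrow> k < n"

fun straight :: "'j set \<Rightarrow> ('j \<Rightarrow> nat) \<Rightarrow> ('j, 'n) node list \<Rightarrow> bool" where
  "straight J ar [] \<longleftrightarrow> True"
| "straight J ar (Compute j as k # rs) \<longleftrightarrow> straight J ar rs \<and> j \<in> J \<and> length as = ar j \<and>
     k = Suc (length rs) \<and> (\<forall>a\<in>set as. avail (length rs) a)"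
| "straight J ar (Negate a k # rs) \<longleftrightarrow> straight J ar rs \<and> k = Suc (length rs) \<and> avail (length rs) a"
| "straight J ar (nd # rs) \<longleftrightarrow> False"

definition val :: "('j \<Rightarrow> nat cpoly) \<Rightarrow> ('j, 'n::finite) node list \<Rightarrow> 'n datum \<Rightarrow> complex ^ 'n
    \<Rightarrow> (nat \<Rightarrow> complex) \<Rightarrow> complex" where
  "val q rs a x \<delta> = the (fetch x (state q x \<delta> rs) a)"

lemma state_defined:
  "straight J ar rs \<Longrightarrow> k < length rs \<Longrightarrow> \<exists>v. state q x \<delta> rs k = Some v"
  by (induction J ar rs rule: straight.induct) (auto simp: Let_def less_Suc_eq)

lemma fetch_val:
  assumes "straight J ar rs" "avail (length rs) a"
  shows "fetch x (state q x \<delta> rs) a = Some (val q rs a x \<delta>)"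
  using assms state_defined[OF assms(1), where q = q and x = x and \<delta> = \<delta>]
  by (cases a) (auto simp: val_def)

lemma val_Input [simp]: "val q rs (Input m) x \<delta> = x $ m"
  by (simp add: val_def)

lemma val_old: "avail (length rs) a \<Longrightarrow> val q (nd # rs) a x \<delta> = val q rs a x \<delta>"
  by (cases a) (auto simp: val_def Let_def split: node.splits)

lemma val_Compute: "val q (Compute j as k # rs) (Result (length rs)) x \<delta> =
    peval (\<lambda>r. map (\<lambda>a. val q rs a x \<delta>) as ! r) (q j) * (1 + \<delta> (length rs))"
  by (simp add: val_def Let_def)

lemma val_Negate: "val q (Negate a k # rs) (Result (length rs)) x \<delta> = - val q rs a x \<delta>"
  by (simp add: val_def Let_def)

lemma avail_mono: "avail n a \<Longrightarrow> n \<le> m \<Longrightarrow> avail m a"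
  by (cases a) auto

lemma exec_straight:
  assumes "straight J ar rs" "exec q (rev rs @ rest) x \<delta> (length rs) (state q x \<delta> rs) y"
  shows "exec q (rev rs @ rest) x \<delta> 0 Map.empty y"
  using assms
proof (induction J ar rs arbitrary: rest rule: straight.induct)
  case (2 J ar j as k rs)
  let ?G = "rev rs @ Compute j as k # rest"
  have args: "map (fetch x (state q x \<delta> rs)) as = map Some (map (\<lambda>a. val q rs a x \<delta>) as)"
    using 2(2) fetch_val[of J ar rs] by auto
  have next_node: "exec q ?G x \<delta> k ((state q x \<delta> rs)(length rs \<mapsto>
      peval (\<lambda>r. map (\<lambda>a. val q rs a x \<delta>) as ! r) (q j) * (1 + \<delta> (length rs)))) y"
    using 2(2,3) by (simp add: Let_def val_def del: fun_upd_apply)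
  have node: "?G ! length rs = Compute j as k" by (metis length_rev nth_append_length)
  have "length rs < length ?G" by simp
  from exec.compute[OF this node args next_node]
  have "exec q ?G x \<delta> (length rs) (state q x \<delta> rs) y" .
  then show ?case using 2(1)[of "Compute j as k # rest"] 2(2) by simp
next
  case (3 J ar a k rs)
  let ?G = "rev rs @ Negate a k # rest"
  have arg: "fetch x (state q x \<delta> rs) a = Some (val q rs a x \<delta>)"
    using 3(2) fetch_val[of J ar rs] by auto
  have next_node: "exec q ?G x \<delta> k ((state q x \<delta> rs)(length rs \<mapsto> - val q rs a x \<delta>)) y"
    using 3(2,3) by (simp add: Let_def val_def del: fun_upd_apply)
  have node: "?G ! length rs = Negate a k" by (metis length_rev nth_append_length)
  have "length rs < length ?G" by simp
  from exec.negate[OF this node arg next_node]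
  have "exec q ?G x \<delta> (length rs) (state q x \<delta> rs) y" .
  then show ?case using 3(1)[of "Negate a k # rest"] 3(2) by simp
qed simp_all

lemma straight_wf:
  assumes "straight J ar rs" "i < length rs" "length rs < N"
  shows "wf_node J ar C N i (rev rs ! i)"
  using assms
  by (induction J ar rs rule: straight.induct) (auto simp: nth_append less_Suc_eq)

lemma straight_algorithm:
  fixes rs :: "('j, 'n::finite) node list"
  assumes "straight J ar rs" "avail (length rs) a"
  shows "is_algorithm J ar q C (rev rs @ [Output a])"
    and "p_comp q (rev rs @ [Output a]) x \<delta> = val q rs a x \<delta>"
proof -
  have ex: "exec q (rev rs @ [Output a]) x \<delta> 0 Map.empty (val q rs a x \<delta>)" for x \<delta>
  proof (rule exec_straight[OF assms(1)])
    have node: "(rev rs @ [Output a]) ! length rs = Output a" by (metis length_rev nth_append_length)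
    have "length rs < length (rev rs @ [Output a])" by simp
    from exec.out[OF this node fetch_val[OF assms]]
    show "exec q (rev rs @ [Output a]) x \<delta> (length rs) (state q x \<delta> rs) (val q rs a x \<delta>)" .
  qed
  then show "p_comp q (rev rs @ [Output a]) x \<delta> = val q rs a x \<delta>" by (rule p_comp_exec)
  have "wf_node J ar C (Suc (length rs)) i ((rev rs @ [Output a]) ! i)" if "i < Suc (length rs)" for i
    using that straight_wf[OF assms(1), of i "Suc (length rs)" C]
    by (cases "i < length rs") (auto simp: nth_append)
  then show "is_algorithm J ar q C (rev rs @ [Output a])"
    using ex unfolding is_algorithm_def by auto
qed

text \<open>The computed value has a relative error that is a product of factors \<open>1 + \<delta>\<^sub>i\<close>; this form is
  preserved by multiplication and by scaling.\<close>

definition computes :: "('j \<Rightarrow> nat cpoly) \<Rightarrow> ('j, 'n::finite) node list \<Rightarrow> 'n datum \<Rightarrow> (complex ^ 'n \<Rightarrow> complex)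
    \<Rightarrow> bool" where
  "computes q rs a v \<longleftrightarrow> avail (length rs) a \<and>
     (\<exists>A. set A \<subseteq> {..<length rs} \<and> (\<forall>x \<delta>. val q rs a x \<delta> = v x * (\<Prod>i\<leftarrow>A. 1 + \<delta> i)))"

lemma computes_old: "computes q rs a v \<Longrightarrow> computes q (nd # rs) a v"
  unfolding computes_def by (fastforce simp: val_old intro: avail_mono)

lemma computes_product:
  assumes "black_box_family J ar q j_mul j_add j_sub" "straight J ar rs"
    and "computes q rs a v" "computes q rs b u"
  obtains nd where "straight J ar (nd # rs)"
    "computes q (nd # rs) (Result (length rs)) (\<lambda>x. v x * u x)"
proof
  let ?nd = "Compute j_mul [a, b] (Suc (length rs))"
  have mul: "j_mul \<in> J" "ar j_mul = 2" "q j_mul = Var 0 * Var 1"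
    using assms(1) by (auto simp: black_box_family_def)
  show "straight J ar (?nd # rs)" using assms mul by (auto simp: computes_def)
  obtain A B where "set A \<subseteq> {..<length rs}" "\<forall>x \<delta>. val q rs a x \<delta> = v x * (\<Prod>i\<leftarrow>A. 1 + \<delta> i)"
    "set B \<subseteq> {..<length rs}" "\<forall>x \<delta>. val q rs b x \<delta> = u x * (\<Prod>i\<leftarrow>B. 1 + \<delta> i)"
    using assms(3,4) unfolding computes_def by blast
  then show "computes q (?nd # rs) (Result (length rs)) (\<lambda>x. v x * u x)"
    unfolding computes_def
    by (intro conjI exI[of _ "length rs # A @ B"]) (auto simp: val_Compute mul(3))
qed

lemma computes_scaled:
  assumes "has_scalar_mult J ar q" "straight J ar rs" "computes q rs a v"
  obtains nd where "straight J ar (nd # rs)"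
    "computes q (nd # rs) (Result (length rs)) (\<lambda>x. c * v x)"
proof -
  obtain j where j: "j \<in> J" "ar j = 1" "q j = Const c * Var 0"
    using assms(1) unfolding has_scalar_mult_def by blast
  let ?nd = "Compute j [a] (Suc (length rs))"
  obtain A where "set A \<subseteq> {..<length rs}" "\<forall>x \<delta>. val q rs a x \<delta> = v x * (\<Prod>i\<leftarrow>A. 1 + \<delta> i)"
    using assms(3) unfolding computes_def by blast
  then have "computes q (?nd # rs) (Result (length rs)) (\<lambda>x. c * v x)"
    unfolding computes_def
    by (intro conjI exI[of _ "length rs # A"]) (auto simp: val_Compute j(3))
  moreover have "straight J ar (?nd # rs)" using assms j by (auto simp: computes_def)
  ultimately show thesis by (rule that[rotated])
qed

text \<open>The exact operands \<open>0\<close>, \<open>x\<^sub>m\<close> and \<open>- x\<^sub>m\<close> of a form.\<close>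

definition supplies :: "('j \<Rightarrow> nat cpoly) \<Rightarrow> ('j, 'n::finite) node list \<Rightarrow> complex \<Rightarrow> 'n \<Rightarrow> bool" where
  "supplies q rs \<sigma> m \<longleftrightarrow> (\<exists>d. avail (length rs) d \<and> (\<forall>x \<delta>. val q rs d x \<delta> = \<sigma> * x $ m))"

lemma supplies_old: "supplies q rs \<sigma> m \<Longrightarrow> supplies q (nd # rs) \<sigma> m"
  unfolding supplies_def by (fastforce simp: val_old intro: avail_mono)

lemma supplies_1: "supplies q rs 1 m"
  unfolding supplies_def by (intro exI[of _ "Input m"]) simp

text \<open>The operand 0 is obtained as the difference of an input with itself; rounding leaves this result exact.\<close>

lemma prelude:
  fixes q :: "'j \<Rightarrow> nat cpoly"
  assumes family: "black_box_family J ar q j_mul j_add j_sub"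
  obtains rs :: "('j, 'n::finite) node list" where "straight J ar rs"
    "\<And>\<sigma> m. \<sigma> \<in> {0, 1, -1} \<Longrightarrow> supplies q rs \<sigma> m"
proof -
  have neg: "\<exists>rs :: ('j, 'n) node list. straight J ar rs \<and> (\<forall>m. supplies q rs 0 m) \<and>
      (\<forall>m\<in>set ms. supplies q rs (-1) m)" for ms
  proof (induction ms)
    case Nil
    have sub: "j_sub \<in> J" "ar j_sub = 2" "q j_sub = Var 0 - Var 1"
      using family by (auto simp: black_box_family_def)
    let ?rs = "[Compute j_sub [Input undefined, Input undefined] 1] :: ('j, 'n) node list"
    have "val q ?rs (Result 0) x \<delta> = 0" for x \<delta>
      using val_Compute[of q j_sub "[Input undefined, Input undefined]" 1 "[]" x \<delta>]
      by (simp add: sub)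
    then have "supplies q ?rs 0 m" for m
      unfolding supplies_def by (intro exI[of _ "Result 0"]) simp
    then show ?case using sub by (intro exI[of _ ?rs]) simp
  next
    case (Cons m ms)
    then obtain rs :: "('j, 'n) node list" where rs: "straight J ar rs" "\<forall>m. supplies q rs 0 m"
      "\<forall>m\<in>set ms. supplies q rs (-1) m" by blast
    let ?rs = "Negate (Input m) (Suc (length rs)) # rs"
    have "supplies q ?rs (-1) m"
      unfolding supplies_def by (intro exI[of _ "Result (length rs)"]) (simp add: val_Negate)
    then show ?case using rs by (intro exI[of _ ?rs]) (auto intro: supplies_old)
  qed
  obtain ms :: "'n list" where "set ms = UNIV" using finite_list[OF finite] by blast
  with neg[of ms] obtain rs :: "('j, 'n) node list"
    where "straight J ar rs" "\<forall>m. supplies q rs 0 m" "\<forall>m. supplies q rs (-1) m" by auto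
  then show thesis using supplies_1 by (intro that) auto
qed

lemma computes_form:
  assumes "straight J ar rs" "\<And>\<sigma> m. \<sigma> \<in> {0, 1, -1} \<Longrightarrow> supplies q rs \<sigma> m"
    and j: "j \<in> J" "vars (q j) \<subseteq> {..<ar j}" and \<sigma>: "\<forall>r. \<sigma> r \<in> {0, 1, -1}"
  obtains nd where "straight J ar (nd # rs)"
    "computes q (nd # rs) (Result (length rs)) (\<lambda>x. form (q j) \<sigma> s (($) x))"
proof -
  have "\<forall>r. \<exists>d. avail (length rs) d \<and> (\<forall>x \<delta>. val q rs d x \<delta> = \<sigma> r * x $ s r)"
    using assms(2) \<sigma> unfolding supplies_def by blast
  then obtain d where d: "\<And>r. avail (length rs) (d r)" "\<And>r x \<delta>. val q rs (d r) x \<delta> = \<sigma> r * x $ s r"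
    by metis
  let ?nd = "Compute j (map d [0..<ar j]) (Suc (length rs))"
  have "peval (\<lambda>r. map (\<lambda>a. val q rs a x \<delta>) (map d [0..<ar j]) ! r) (q j) =
      form (q j) \<sigma> s (($) x)" for x \<delta>
    unfolding form_def using j(2) by (intro peval_cong) (auto simp: d(2))
  then have "computes q (?nd # rs) (Result (length rs)) (\<lambda>x. form (q j) \<sigma> s (($) x))"
    unfolding computes_def by (intro conjI exI[of _ "[length rs]"]) (auto simp: val_Compute)
  moreover have "straight J ar (?nd # rs)" using assms(1) j d(1) by auto
  ultimately show thesis by (rule that[rotated])
qed

lemma computes_product_of_forms:
  assumes family: "black_box_family J ar q j_mul j_add j_sub"
    and "straight J ar rs" "\<And>\<sigma> m. \<sigma> \<in> {0, 1, -1} \<Longrightarrow> supplies q rs \<sigma> m"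
    and "computes q rs a v" "set ls \<subseteq> forms J q"
  shows "\<exists>rs' a'. straight J ar rs' \<and> computes q rs' a' (\<lambda>x. (\<Prod>l\<leftarrow>ls. l (($) x)) * v x)"
  using assms(2-5)
proof (induction ls arbitrary: rs a v)
  case Nil
  then show ?case by (intro exI[of _ rs] exI[of _ a]) simp
next
  case (Cons l ls)
  from Cons.prems(4) have "l \<in> forms J q" by simp
  then obtain j \<sigma> s where l: "j \<in> J" "\<forall>r. \<sigma> r \<in> {0, 1, -1}" "l = form (q j) \<sigma> s"
    unfolding forms_def by blast
  have "vars (q j) \<subseteq> {..<ar j}" using family l(1) by (auto simp: black_box_family_def)
  then obtain nd where nd: "straight J ar (nd # rs)"
    "computes q (nd # rs) (Result (length rs)) (\<lambda>x. l (($) x))"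
    using computes_form[OF Cons.prems(1,2) l(1) _ l(2), of s] unfolding l(3) by blast
  obtain nd' where nd': "straight J ar (nd' # nd # rs)"
    "computes q (nd' # nd # rs) (Result (length (nd # rs))) (\<lambda>x. l (($) x) * v x)"
    using computes_product[OF family nd(1) nd(2) computes_old[OF Cons.prems(3)]] by blast
  have "supplies q (nd' # nd # rs) \<sigma> m" if "\<sigma> \<in> {0, 1, -1}" for \<sigma> m
    by (intro supplies_old Cons.prems(2) that)
  from Cons.IH[OF nd'(1) this nd'(2)] Cons.prems(4) show ?case by (simp add: mult_ac)
qed

lemma rounding_factors_near_1:
  fixes \<eta> :: real
  assumes "0 < \<eta>" "\<eta> < 1"
  shows "\<exists>\<epsilon>>0. \<epsilon> < 1 \<and> (\<forall>\<delta> :: nat \<Rightarrow> complex. (\<forall>i\<in>set A. norm (\<delta> i) \<le> \<epsilon>) \<longrightarrow>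
    norm ((\<Prod>i\<leftarrow>A. 1 + \<delta> i) - 1) \<le> \<eta>)"
  using assms
proof (induction A arbitrary: \<eta>)
  case Nil
  then show ?case by (intro exI[of _ "1 / 2"]) auto
next
  case (Cons k A)
  from Cons.IH[of "\<eta> / 2"] Cons.prems obtain \<epsilon> where \<epsilon>: "0 < \<epsilon>" "\<epsilon> < 1" and
    IH: "\<And>\<delta> :: nat \<Rightarrow> complex. \<forall>i\<in>set A. norm (\<delta> i) \<le> \<epsilon> \<Longrightarrow>
      norm ((\<Prod>i\<leftarrow>A. 1 + \<delta> i) - 1) \<le> \<eta> / 2" by auto
  show ?case
  proof (intro exI[of _ "min \<epsilon> (\<eta> / 4)"] conjI allI impI)
    fix \<delta> :: "nat \<Rightarrow> complex"
    assume \<delta>: "\<forall>i\<in>set (k # A). norm (\<delta> i) \<le> min \<epsilon> (\<eta> / 4)"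
    let ?E = "\<Prod>i\<leftarrow>A. 1 + \<delta> i"
    have E: "norm (?E - 1) \<le> \<eta> / 2" using \<delta> by (intro IH) auto
    have "norm ?E \<le> norm (?E - 1) + norm (1 :: complex)"
      by (metis diff_add_cancel norm_triangle_ineq)
    with E Cons.prems have "norm ?E \<le> 2" by simp
    with \<delta> Cons.prems have "norm (\<delta> k) * norm ?E \<le> \<eta> / 4 * 2"
      by (intro mult_mono) auto
    moreover have "(\<Prod>i\<leftarrow>k # A. 1 + \<delta> i) - 1 = (?E - 1) + \<delta> k * ?E"
      by (simp add: algebra_simps)
    then have "norm ((\<Prod>i\<leftarrow>k # A. 1 + \<delta> i) - 1) \<le> norm (?E - 1) + norm (\<delta> k) * norm ?E"
      by (metis norm_mult norm_triangle_ineq)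
    ultimately show "norm ((\<Prod>i\<leftarrow>k # A. 1 + \<delta> i) - 1) \<le> \<eta>" using E by simp
  qed (use \<epsilon> Cons.prems in auto)
qed

lemma computes_imp_evaluable:
  fixes p :: "'n::finite cpoly"
  assumes "straight J ar rs" "computes q rs a (\<lambda>x. peval (($) x) p)"
  shows "accurately_evaluable_on J ar q C p UNIV"
proof -
  let ?G = "rev rs @ [Output a]"
  obtain A where av: "avail (length rs) a" and A: "set A \<subseteq> {..<length rs}"
    "\<And>x \<delta>. val q rs a x \<delta> = peval (($) x) p * (\<Prod>i\<leftarrow>A. 1 + \<delta> i)"
    using assms(2) unfolding computes_def by blast
  note alg = straight_algorithm[OF assms(1) av, where q = q]
  have "accurate_on q ?G p UNIV"
    unfolding accurate_on_def
  proof (intro allI impI)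
    fix \<eta> :: real assume \<eta>: "0 < \<eta> \<and> \<eta> < 1"
    then obtain \<epsilon> where \<epsilon>: "0 < \<epsilon>" "\<epsilon> < 1" "\<And>\<delta> :: nat \<Rightarrow> complex.
        \<forall>i\<in>set A. norm (\<delta> i) \<le> \<epsilon> \<Longrightarrow> norm ((\<Prod>i\<leftarrow>A. 1 + \<delta> i) - 1) \<le> \<eta>"
      using rounding_factors_near_1[of \<eta> A] by blast
    have "norm (p_comp q ?G x \<delta> - peval (($) x) p) \<le> \<eta> * norm (peval (($) x) p)"
      if \<delta>: "\<forall>i<length ?G. norm (\<delta> i) \<le> \<epsilon>" for x \<delta>
    proof -
      have "p_comp q ?G x \<delta> - peval (($) x) p = peval (($) x) p * ((\<Prod>i\<leftarrow>A. 1 + \<delta> i) - 1)"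
        by (simp add: alg(2) A(2) algebra_simps)
      moreover have "norm ((\<Prod>i\<leftarrow>A. 1 + \<delta> i) - 1) \<le> \<eta>"
        using \<delta> A(1) by (intro \<epsilon>(3)) auto
      ultimately show ?thesis
        by (simp add: norm_mult mult.commute[of \<eta>] mult_left_mono)
    qed
    with \<epsilon>(1,2) show "\<exists>\<epsilon>>0. \<epsilon> < 1 \<and> (\<forall>x\<in>UNIV. \<forall>\<delta>. (\<forall>i<length ?G. norm (\<delta> i) \<le> \<epsilon>) \<longrightarrow>
        norm (p_comp q ?G x \<delta> - peval (($) x) p) \<le> \<eta> * norm (peval (($) x) p))"
      by blast
  qed
  moreover have "p_comp q ?G x (\<lambda>_. 0) = peval (($) x) p" for x
  proof -
    have "(\<Prod>i\<leftarrow>A. 1 + (\<lambda>_. 0 :: complex) i) = 1" by (induction A) auto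
    then show ?thesis by (simp add: alg(2) A(2))
  qed
  ultimately show ?thesis unfolding accurately_evaluable_on_def using alg(1) by blast
qed

section \<open>Evaluation of products of forms\<close>

text \<open>The value at the origin shows how a nonzero constant is computed: by a black box with nonzero
  constant coefficient, applied to zeros.\<close>

lemma peval_at_0: "peval (\<lambda>_. 0) p = lookup p 0"
proof -
  have "mon (\<lambda>_. 0) m = (if m = 0 then 1 else 0)" for m :: "'a \<Rightarrow>\<^sub>0 nat"
  proof (cases "m = 0")
    case False
    then obtain i where "i \<in> keys m" using keys_eq_empty by blast
    then have "(\<Prod>i\<in>keys m. (0 :: complex) ^ lookup m i) = 0"
      by (intro prod_zero) (auto simp: in_keys_iff intro!: bexI[of _ i])
    with False show ?thesis by (simp add: mon_def)
  qed simp
  then have "peval (\<lambda>_. 0) p = (\<Sum>m\<in>keys p. if m = 0 then lookup p m else 0)"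
    unfolding peval_mon by (intro sum.cong) auto
  then show ?thesis by (simp add: in_keys_iff)
qed

text \<open>Each point of a variety in the union lies on a hyperplane, given by a form, that is contained in the
  variety. Hence the zeros of \<open>p\<close> are a union of such hyperplanes and \<open>p\<close> is a
  multiple of a product of forms. Each form is computed by one black box from exact operands,
  and products and scalings preserve relative accuracy.\<close>

lemma union_imp_evaluable:
  fixes q :: "'j \<Rightarrow> nat cpoly" and p :: "'n::finite cpoly"
  assumes family: "black_box_family J ar q j_mul j_add j_sub"
    and scalar: "has_scalar_mult J ar q"
    and affine: "\<forall>j\<in>J - {j_mul}. affine_poly (q j)"
    and const: "\<forall>c. c \<noteq> 0 \<and> p = Const c \<longrightarrow> (\<exists>j\<in>J. lookup (q j) 0 \<noteq> 0)"
    and F: "F \<subseteq> (\<Union>j\<in>J. black_box_varieties (ar j) (q j))" "zero_set p = \<Union>F"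
  shows "accurately_evaluable_on J ar q C p UNIV"
proof -
  obtain rs :: "('j, 'n) node list" where rs: "straight J ar rs"
    "\<And>\<sigma> m. \<sigma> \<in> {0, 1, -1} \<Longrightarrow> supplies q rs \<sigma> m"
    using prelude[OF family] by blast
  have vars: "vars (q j) \<subseteq> {..<ar j}" if "j \<in> J" for j
    using family that by (auto simp: black_box_family_def)
  show ?thesis
  proof (cases "\<forall>x. peval x p = 0")
    case True
    have "supplies q rs 0 undefined" by (rule rs(2)) simp
    then obtain d where "avail (length rs) d" "\<forall>x \<delta>. val q rs d x \<delta> = 0"
      unfolding supplies_def by auto
    then have "computes q rs d (\<lambda>x. peval (($) x) p)"
      unfolding computes_def using True by (intro conjI exI[of _ "[]"]) auto
    with rs(1) show ?thesis by (rule computes_imp_evaluable)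
  next
    case False
    then obtain a where a: "peval a p \<noteq> 0" by blast
    let ?K = "J - {j_mul}"
    define L :: "(('n \<Rightarrow> complex) \<Rightarrow> complex) set" where
      "L = {l \<in> forms ?K q. nonconst_affine l \<and> (\<forall>x. l x = 0 \<longrightarrow> peval x p = 0)}"
    have sub: "j_sub \<in> ?K" "q j_sub = Var 0 - Var 1" and mul: "q j_mul = Var 0 * Var 1"
      using family sub_neq_mul by (auto simp: black_box_family_def)
    have zeros: "peval x p = 0 \<longleftrightarrow> (\<exists>l\<in>L. l x = 0)" for x
    proof
      assume "peval x p = 0"
      define x0 :: "complex ^ 'n" where "x0 = (\<chi> i. x i)"
      have x0: "($) x0 = x" by (auto simp: x0_def)
      have "x0 \<in> \<Union>F" using \<open>peval x p = 0\<close> F(2) by (auto simp: zero_set_def x0)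
      then obtain S where S: "S \<in> F" "x0 \<in> S" by blast
      with F(1) obtain j where j: "j \<in> J" "S \<in> black_box_varieties (ar j) (q j)" by blast
      have Sp: "peval y p = 0" if "(\<chi> i. y i) \<in> S" for y
      proof -
        have "(\<chi> i. y i) \<in> zero_set p" using that S(1) F(2) by blast
        moreover have "($) (\<chi> i. y i) = y" by auto
        ultimately show ?thesis by (simp add: zero_set_def)
      qed
      have "S \<noteq> UNIV" using Sp[of a] a by auto
      have "\<exists>j'\<in>?K. \<exists>\<sigma> s. (\<forall>r. \<sigma> r \<in> {0, 1, -1}) \<and> form (q j') \<sigma> s x = 0 \<and>
          {y. form (q j') \<sigma> s (($) y) = 0} \<subseteq> S"
      proof (cases "j = j_mul")
        case True
        then obtain m where m: "x m = 0" "{y. y $ m = 0} \<subseteq> S"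
          using product_variety_contains_hyperplane[of S "ar j" x0] j(2) S(2) \<open>S \<noteq> UNIV\<close> mul
          by (auto simp: x0_def)
        then show ?thesis using sub coordinate_form[of m]
          by (intro bexI[of _ j_sub] exI[of _ "\<lambda>r. if r = 0 then 1 else 0"] exI[of _ "\<lambda>_. m"]) auto
      next
        case False
        then show ?thesis
          using affine_variety_contains_form_zeros[OF _ vars j(2) S(2)] affine j(1) x0 by auto
      qed
      then obtain j' \<sigma> s where l: "j' \<in> ?K" "\<forall>r. \<sigma> r \<in> {0, 1, -1}" "form (q j') \<sigma> s x = 0"
        "{y. form (q j') \<sigma> s (($) y) = 0} \<subseteq> S" by blast
      have van: "peval y p = 0" if "form (q j') \<sigma> s y = 0" for y
      proof (rule Sp)
        have "($) (\<chi> i. y i) = y" by auto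
        then show "(\<chi> i. y i) \<in> S" using l(4) that by auto
      qed
      have "nonconst_affine (form (q j') \<sigma> s)"
      proof (rule ccontr)
        assume "\<not> ?thesis"
        then have "\<forall>y. form (q j') \<sigma> s y = form (q j') \<sigma> s (\<lambda>_. 0)"
          using form_cases[of "q j'" "ar j'"] affine vars l(1) by blast
        then have "form (q j') \<sigma> s a = 0" using l(3) by metis
        with van a show False by blast
      qed
      then have "form (q j') \<sigma> s \<in> L" using l(1,2) van unfolding L_def forms_def by blast
      with l(3) show "\<exists>l\<in>L. l x = 0" by blast
    qed (auto simp: L_def)
    have "\<exists>ls c. set ls \<subseteq> L \<and> c \<noteq> 0 \<and> (\<forall>x. peval x p = (\<Prod>l\<leftarrow>ls. l x) * c)"
    proof (rule product_of_affine[of "\<lambda>x. peval x p", OF _ a _ zeros])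
      show "polyfun (\<lambda>x. peval x p)" by (rule polyfun_peval) simp
    qed (auto simp: L_def)
    then obtain ls c where ls: "set ls \<subseteq> L" "c \<noteq> 0" "\<forall>x. peval x p = (\<Prod>l\<leftarrow>ls. l x) * c"
      by (elim exE conjE)
    have forms: "set ls \<subseteq> forms J q" using ls(1) unfolding L_def forms_def by blast
    have "\<exists>rs' d b. straight J ar rs' \<and> computes q rs' d (\<lambda>x. (\<Prod>l\<leftarrow>ls. l (($) x)) * b) \<and> b \<noteq> 0"
    proof (cases ls)
      case Nil
      then have "peval x p = peval x (Const c)" for x using ls(3) by simp
      then have "p = Const c" by (rule peval_eq_imp_eq)
      with const ls(2) obtain j where j: "j \<in> J" "lookup (q j) 0 \<noteq> 0" by blast
      obtain nd where nd: "straight J ar (nd # rs)" "computes q (nd # rs) (Result (length rs))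
          (\<lambda>x. form (q j) (\<lambda>_. 0) (\<lambda>_. undefined) (($) x))"
        using computes_form[OF rs j(1) vars[OF j(1)], of "\<lambda>_. 0" "\<lambda>_. undefined"] by auto
      have "form (q j) (\<lambda>_. 0) (\<lambda>_. undefined) (($) x) = lookup (q j) 0" for x :: "complex ^ 'n"
        by (simp add: form_def peval_at_0)
      with nd have "computes q (nd # rs) (Result (length rs)) (\<lambda>x. (\<Prod>l\<leftarrow>ls. l (($) x)) * lookup (q j) 0)"
        by (simp add: Nil)
      with nd(1) j(2) show ?thesis by blast
    next
      case (Cons l ls')
      then have "l \<in> forms J q" using forms by simp
      then obtain j \<sigma> s where l: "j \<in> J" "\<forall>r. \<sigma> r \<in> {0, 1, -1}" "l = form (q j) \<sigma> s"
        unfolding forms_def by blast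
      obtain nd where nd: "straight J ar (nd # rs)"
        "computes q (nd # rs) (Result (length rs)) (\<lambda>x. l (($) x))"
        using computes_form[OF rs l(1) vars[OF l(1)] l(2), of s] unfolding l(3) by blast
      have "\<exists>rs' d. straight J ar rs' \<and>
          computes q rs' d (\<lambda>x. (\<Prod>l\<leftarrow>ls'. l (($) x)) * l (($) x))"
        using forms Cons
        by (intro computes_product_of_forms[OF family nd(1) _ nd(2)] supplies_old rs(2)) auto
      then obtain rs' d where rs': "straight J ar rs'"
        "computes q rs' d (\<lambda>x. (\<Prod>l\<leftarrow>ls'. l (($) x)) * l (($) x))" by (elim exE conjE)
      from rs'(2) have "computes q rs' d (\<lambda>x. (\<Prod>l\<leftarrow>ls. l (($) x)) * 1)"
        by (simp add: Cons mult.commute)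
      with rs'(1) show ?thesis by (intro exI[of _ rs'] exI[of _ d] exI[of _ "1 :: complex"]) simp
    qed
    then obtain rs' d b where rs': "straight J ar rs'"
      "computes q rs' d (\<lambda>x. (\<Prod>l\<leftarrow>ls. l (($) x)) * b)" "b \<noteq> 0" by blast
    obtain nd where nd: "straight J ar (nd # rs')"
      "computes q (nd # rs') (Result (length rs')) (\<lambda>x. c / b * ((\<Prod>l\<leftarrow>ls. l (($) x)) * b))"
      using computes_scaled[OF scalar rs'(1,2)] by blast
    have "(\<lambda>x. c / b * ((\<Prod>l\<leftarrow>ls. l (($) x)) * b)) = (\<lambda>x :: complex ^ 'n. peval (($) x) p)"
      using ls(3) rs'(3) by (intro ext) simp
    with nd(2) have "computes q (nd # rs') (Result (length rs')) (\<lambda>x. peval (($) x) p)" by simp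
    with nd(1) show ?thesis by (rule computes_imp_evaluable)
  qed
qed

theorem theorem3p39:
  fixes J :: "'j set" and ar :: "'j \<Rightarrow> nat" and q :: "'j \<Rightarrow> nat cpoly"
    and j_mul j_add j_sub :: 'j
    and C :: "(complex \<Rightarrow> complex \<Rightarrow> bool) set"
    and p :: "('n::finite) cpoly"
  assumes family: "black_box_family J ar q j_mul j_add j_sub"
    and scalar: "has_scalar_mult J ar q"
    and affine: "\<forall>j\<in>J - {j_mul}. affine_poly (q j)"
    and const: "\<forall>c. c \<noteq> 0 \<and> p = Const c \<longrightarrow> (\<exists>j\<in>J. Poly_Mapping.lookup (q j) 0 \<noteq> 0)"
  shows "accurately_evaluable_on J ar q C p UNIV \<longleftrightarrow>
    (\<exists>F. F \<subseteq> (\<Union>j\<in>J. black_box_varieties (ar j) (q j)) \<and> zero_set p = \<Union>F)"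
proof
  assume "accurately_evaluable_on J ar q C p UNIV"
  then show "\<exists>F. F \<subseteq> (\<Union>j\<in>J. black_box_varieties (ar j) (q j)) \<and> zero_set p = \<Union>F"
    by (rule evaluable_imp_union[OF family affine])
next
  assume "\<exists>F. F \<subseteq> (\<Union>j\<in>J. black_box_varieties (ar j) (q j)) \<and> zero_set p = \<Union>F"
  then show "accurately_evaluable_on J ar q C p UNIV"
    using union_imp_evaluable[OF family scalar affine const] by blast
qed

end
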